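(* Up to sign of the $f$-structure and up to homothety of the metric, all invariant strictly Killing (i.e. Killing and non-Kähler) $f$-structures on the flag manifold $M=SU(3)/T_{max}$, together with the corresponding invariant Riemannian metrics, are exactly the following: $$ \begin{array}{ll} J_1=(1,1,1), & g=(1,1,1);\\ f_1=(1,1,0), & g=(3,3,4);\\ f_2=(1,0,1), & g=(3,4,3);\\ f_3=(0,1,1), & g=(4,3,3). \end{array} $$ In particular, there are no invariant Killing $f$-structures of rank $2$ on $M$.
   Context: Setting. $T_{max}\subset SU(3)$ is the subgroup of diagonal matrices. Let $\mathfrak g=\mathfrak{su}(3)=\mathfrak h\oplus\mathfrak m$, where $\mathfrak h$ consists of the diagonal matrices in $\mathfrak{su}(3)$ and $\mathfrak m$ consists of the matrices $$D(a,b,c)=\begin{pmatrix}0&a&\overline c\\-\overline a&0&b\\-c&-\overline b&0\end{pmatrix},\quad a,b,c\in\mathbb C.$$ Identify $\mathfrak m$ with the tangent space $T_o M$ of $M=SU(3)/T_{max}$ at $o=T_{max}$. Put $\mathfrak m_1=\{D(a,0,0)\}$, $\mathfrak m_2=\{D(0,b,0)\}$, $\mathfrak m_3=\{D(0,0,c)\}$, so $\mathfrak m=\mathfrak m_1\oplus\mathfrak m_2\oplus\mathfrak m_3$. Invariant metrics. Let $\langle X,Y\rangle_o=-\frac12\operatorname{Re}\operatorname{tr}(XY)$. For $\lambda_1,\lambda_2,\lambda_3>0$, $g=(\lambda_1,\lambda_2,\lambda_3)$ denotes the $SU(3)$-invariant Riemannian metric on $M$ whose value at $o$ makes the $\mathfrak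 m_j$ mutually orthogonal and equals $\lambda_j\langle\cdot,\cdot\rangle_o$ on $\mathfrak m_j$, $j=1,2,3$. Every $SU(3)$-invariant Riemannian metric on $M$ is of this form. Invariant $f$-structures. An $f$-structure is a $(1,1)$-tensor field $f$ with $f^3+f=0$; its rank is $\dim \operatorname{Im} f$. For $\zeta_1,\zeta_2,\zeta_3\in\{-1,0,1\}$, $f=(\zeta_1,\zeta_2,\zeta_3)$ denotes the $SU(3)$-invariant $f$-structure on $M$ given at $o$ by $D(a,b,c)\mapsto D(\zeta_1 ia,\zeta_2 ib,\zeta_3 ic)$. Every $SU(3)$-invariant $f$-structure on $M$ is of this form, and each is a metric $f$-structure (i.e. $g(fX,Y)+g(X,fY)=0$) for every invariant Riemannian metric $g$. Invariant $f$-structures are considered up to sign. Classes. Let $\nabla$ be the Levi-Civita connection of $g$ and $\nabla_X(f)Y=\nabla_X(fY)-f\nabla_XY$. A metric $f$-structure $f$ on $(M,g)$ is a Kähler $f$-structure if $\nabla_X(f)Y=0$ for all vector fields $X,Y$; it is a Killing $f$-structure if $\nabla_X(f)X=0$ for all vector fields $X$. *)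

theory Defs
  imports "HOL-Analysis.Analysis" "HOL-Library.Function_Algebras"
begin

(* Pointwise real vector space structure on functions; tangent vectors and vector fields
   below are functions, so this makes their sums, multiples and dim available. *)

instantiation "fun" :: (type, real_vector) real_vector
begin

definition scaleR_fun :: "real \<Rightarrow> ('a \<Rightarrow> 'b) \<Rightarrow> 'a \<Rightarrow> 'b"
  where "scaleR_fun c h = (\<lambda>x. c *\<^sub>R h x)"

instance
  by standard (auto simp: scaleR_fun_def fun_eq_iff scaleR_add_right scaleR_add_left)

end

section \<open>The flag manifold\<close>

type_synonym mat3 = "complex^3^3"

definition SU3 :: "mat3 set"
  where "SU3 = {A. A ** map_matrix cnj (transpose A) = mat 1 \<and> det A = 1}"

definition Tmax :: "mat3 set"
  where "Tmax = {A \<in> SU3. \<forall>i j. i \<noteq> j \<longrightarrow> A $ i $ j = 0}"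

typedef flag = "(\<lambda>x. (\<lambda>t. x ** t) ` Tmax) ` SU3"
proof -
  have "mat 1 \<in> SU3"
    by (simp add: SU3_def vec_eq_iff matrix_matrix_mult_def mat_def transpose_def det_3 sum_3
        forall_3)
  then show ?thesis by blast
qed

text \<open>Only meaningful for arguments in \<^term>\<open>SU3\<close>.\<close>

definition proj :: "mat3 \<Rightarrow> flag"
  where "proj x = Abs_flag ((\<lambda>t. x ** t) ` Tmax)"

definition act :: "mat3 \<Rightarrow> flag \<Rightarrow> flag"
  where "act k p = Abs_flag ((\<lambda>x. k ** x) ` Rep_flag p)"

definition base_point :: flag
  where "base_point = proj (mat 1)"

section \<open>Smooth functions, tangent vectors, vector fields\<close>

primrec C_k_on :: "nat \<Rightarrow> ('a::euclidean_space \<Rightarrow> real) \<Rightarrow> 'a set \<Rightarrow> bool"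
  where
    "C_k_on 0 F U \<longleftrightarrow> continuous_on U F"
  | "C_k_on (Suc n) F U \<longleftrightarrow>
       (\<forall>x\<in>U. F differentiable (at x)) \<and>
       (\<forall>v. C_k_on n (\<lambda>x. frechet_derivative F (at x) v) U)"

definition C_infinity_on :: "('a::euclidean_space \<Rightarrow> real) \<Rightarrow> 'a set \<Rightarrow> bool"
  where "C_infinity_on F U \<longleftrightarrow> (\<forall>n. C_k_on n F U)"

text \<open>
  The quotient manifold structure: since \<^const>\<open>proj\<close> is a surjective submersion, a function on
  the flag manifold is smooth iff its pull-back to the embedded submanifold \<^term>\<open>SU3\<close> of the
  space of matrices is smooth, i.e. locally the restriction of a smooth function of matrices.
\<close>

definition smooth_fun :: "(flag \<Rightarrow> real) \<Rightarrow> bool"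
  where "smooth_fun \<phi> \<longleftrightarrow>
    (\<forall>x\<in>SU3. \<exists>U F. open U \<and> x \<in> U \<and> C_infinity_on F U \<and> (\<forall>y\<in>U \<inter> SU3. \<phi> (proj y) = F y))"

text \<open>
  A tangent vector at \<open>p\<close> is the velocity of a curve through \<open>p\<close>, regarded as a functional on
  smooth functions. Functionals are normalised to vanish on functions that are not smooth, so
  that equality of tangent vectors is equality of functions.
\<close>

type_synonym tangent = "(flag \<Rightarrow> real) \<Rightarrow> real"

definition tangent_space :: "flag \<Rightarrow> tangent set"
  where "tangent_space p = {v.
    (\<exists>\<gamma>. \<gamma> 0 = p \<and>
      (\<forall>\<phi>. smooth_fun \<phi> \<longrightarrow> ((\<lambda>t. \<phi> (\<gamma> t)) has_real_derivative v \<phi>) (at 0))) \<and>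
    (\<forall>\<phi>. \<not> smooth_fun \<phi> \<longrightarrow> v \<phi> = 0)}"

type_synonym vfield = "flag \<Rightarrow> tangent"

definition deriv_along :: "vfield \<Rightarrow> (flag \<Rightarrow> real) \<Rightarrow> flag \<Rightarrow> real"
  where "deriv_along X \<phi> = (\<lambda>p. X p \<phi>)"

definition vector_fields :: "vfield set"
  where "vector_fields = {X.
    (\<forall>p. X p \<in> tangent_space p) \<and> (\<forall>\<phi>. smooth_fun \<phi> \<longrightarrow> smooth_fun (deriv_along X \<phi>))}"

definition fun_scale :: "(flag \<Rightarrow> real) \<Rightarrow> vfield \<Rightarrow> vfield"
  where "fun_scale \<phi> X = (\<lambda>p. \<phi> p *\<^sub>R X p)"

definition lie_bracket :: "vfield \<Rightarrow> vfield \<Rightarrow> vfield"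
  where "lie_bracket X Y = (\<lambda>p \<phi>. X p (deriv_along Y \<phi>) - Y p (deriv_along X \<phi>))"

text \<open>The differential of the diffeomorphism \<^term>\<open>act k\<close>.\<close>

definition push :: "mat3 \<Rightarrow> tangent \<Rightarrow> tangent"
  where "push k v = (\<lambda>\<phi>. v (\<lambda>p. \<phi> (act k p)))"

section \<open>The tangent space at the base point\<close>

definition D :: "complex \<Rightarrow> complex \<Rightarrow> complex \<Rightarrow> mat3"
  where "D a b c = vector [vector [0, a, cnj c],
                           vector [- cnj a, 0, b],
                           vector [- c, - cnj b, 0]]"

text \<open>
  The differential of \<^const>\<open>proj\<close> at the identity, for \<open>A\<close> in the Lie algebra of \<^term>\<open>SU3\<close>
  (the derivative is independent of the curve). Restricted to the matrices \<open>D a b c\<close> it is the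
  identification of these matrices with the tangent space at the base point.
\<close>

definition dproj :: "mat3 \<Rightarrow> tangent"
  where "dproj A = (\<lambda>\<phi>. if smooth_fun \<phi> then
      (THE d. \<forall>\<gamma>::real \<Rightarrow> mat3.
        (\<forall>t. \<gamma> t \<in> SU3) \<and> \<gamma> 0 = mat 1 \<and> (\<gamma> has_vector_derivative A) (at 0) \<longrightarrow>
        ((\<lambda>t. \<phi> (proj (\<gamma> t))) has_real_derivative d) (at 0))
    else 0)"

definition inner_o :: "mat3 \<Rightarrow> mat3 \<Rightarrow> real"
  where "inner_o X Y = - (1/2) * Re (trace (X ** Y))"

section \<open>Invariant Riemannian metrics\<close>

text \<open>
  A covariant 2-tensor field or a (1,1)-tensor field is a family indexed by points; its values
  on arguments outside the tangent space are irrelevant and never constrained.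
\<close>

type_synonym metric = "flag \<Rightarrow> tangent \<Rightarrow> tangent \<Rightarrow> real"

definition riemannian_metric :: "metric \<Rightarrow> bool"
  where "riemannian_metric g \<longleftrightarrow>
    (\<forall>p. \<forall>u\<in>tangent_space p. \<forall>v\<in>tangent_space p. \<forall>w\<in>tangent_space p. \<forall>c.
       g p u v = g p v u \<and>
       g p (u + v) w = g p u w + g p v w \<and>
       g p (c *\<^sub>R u) w = c * g p u w) \<and>
    (\<forall>p. \<forall>v\<in>tangent_space p. v \<noteq> 0 \<longrightarrow> g p v v > 0) \<and>
    (\<forall>X\<in>vector_fields. \<forall>Y\<in>vector_fields. smooth_fun (\<lambda>p. g p (X p) (Y p)))"

definition invariant_metric :: "metric \<Rightarrow> bool"
  where "invariant_metric g \<longleftrightarrow> riemannian_metric g \<and>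
    (\<forall>k\<in>SU3. \<forall>p. \<forall>v\<in>tangent_space p. \<forall>w\<in>tangent_space p.
       g (act k p) (push k v) (push k w) = g p v w)"

text \<open>The metric is \<open>(l1, l2, l3)\<close> in terms of its value at the base point.\<close>

definition metric_is :: "metric \<Rightarrow> real \<times> real \<times> real \<Rightarrow> bool"
  where "metric_is g = (\<lambda>(l1, l2, l3). \<forall>a b c a' b' c'.
    g base_point (dproj (D a b c)) (dproj (D a' b' c')) =
      l1 * inner_o (D a 0 0) (D a' 0 0) +
      l2 * inner_o (D 0 b 0) (D 0 b' 0) +
      l3 * inner_o (D 0 0 c) (D 0 0 c'))"

section \<open>The Levi-Civita connection\<close>

type_synonym connection = "vfield \<Rightarrow> vfield \<Rightarrow> vfield"

definition affine_connection :: "connection \<Rightarrow> bool"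
  where "affine_connection nabla \<longleftrightarrow>
    (\<forall>X\<in>vector_fields. \<forall>Y\<in>vector_fields. nabla X Y \<in> vector_fields) \<and>
    (\<forall>X\<in>vector_fields. \<forall>Y\<in>vector_fields. \<forall>Z\<in>vector_fields.
       nabla (X + Y) Z = nabla X Z + nabla Y Z \<and>
       nabla X (Y + Z) = nabla X Y + nabla X Z) \<and>
    (\<forall>X\<in>vector_fields. \<forall>Y\<in>vector_fields. \<forall>\<phi>. smooth_fun \<phi> \<longrightarrow>
       nabla (fun_scale \<phi> X) Y = fun_scale \<phi> (nabla X Y) \<and>
       nabla X (fun_scale \<phi> Y) = fun_scale (deriv_along X \<phi>) Y + fun_scale \<phi> (nabla X Y))"

definition levi_civita :: "metric \<Rightarrow> connection \<Rightarrow> bool"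
  where "levi_civita g nabla \<longleftrightarrow> affine_connection nabla \<and>
    (\<forall>X\<in>vector_fields. \<forall>Y\<in>vector_fields. nabla X Y - nabla Y X = lie_bracket X Y) \<and>
    (\<forall>X\<in>vector_fields. \<forall>Y\<in>vector_fields. \<forall>Z\<in>vector_fields. \<forall>p.
       deriv_along X (\<lambda>q. g q (Y q) (Z q)) p =
         g p (nabla X Y p) (Z p) + g p (Y p) (nabla X Z p))"

section \<open>Invariant f-structures\<close>

type_synonym tensor11 = "flag \<Rightarrow> tangent \<Rightarrow> tangent"

definition tensor_apply :: "tensor11 \<Rightarrow> vfield \<Rightarrow> vfield"
  where "tensor_apply f X = (\<lambda>p. f p (X p))"

definition f_structure :: "tensor11 \<Rightarrow> bool"
  where "f_structure f \<longleftrightarrow>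
    (\<forall>p. \<forall>v\<in>tangent_space p. \<forall>w\<in>tangent_space p. \<forall>c.
       f p v \<in> tangent_space p \<and>
       f p (v + w) = f p v + f p w \<and>
       f p (c *\<^sub>R v) = c *\<^sub>R f p v \<and>
       f p (f p (f p v)) + f p v = 0) \<and>
    (\<forall>X\<in>vector_fields. tensor_apply f X \<in> vector_fields)"

definition invariant_f_structure :: "tensor11 \<Rightarrow> bool"
  where "invariant_f_structure f \<longleftrightarrow> f_structure f \<and>
    (\<forall>k\<in>SU3. \<forall>p. \<forall>v\<in>tangent_space p. f (act k p) (push k v) = push k (f p v))"

definition has_rank :: "tensor11 \<Rightarrow> nat \<Rightarrow> bool"
  where "has_rank f r \<longleftrightarrow> (\<forall>p. dim (f p ` tangent_space p) = r)"

text \<open>The f-structure is \<open>(z1, z2, z3)\<close> in terms of its value at the base point.\<close>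

definition f_structure_is :: "tensor11 \<Rightarrow> real \<times> real \<times> real \<Rightarrow> bool"
  where "f_structure_is f = (\<lambda>(z1, z2, z3). \<forall>a b c.
    f base_point (dproj (D a b c)) =
      dproj (D (of_real z1 * \<i> * a) (of_real z2 * \<i> * b) (of_real z3 * \<i> * c)))"

definition metric_f_structure :: "metric \<Rightarrow> tensor11 \<Rightarrow> bool"
  where "metric_f_structure g f \<longleftrightarrow> f_structure f \<and>
    (\<forall>p. \<forall>v\<in>tangent_space p. \<forall>w\<in>tangent_space p. g p (f p v) w + g p v (f p w) = 0)"

definition nabla_f :: "connection \<Rightarrow> tensor11 \<Rightarrow> vfield \<Rightarrow> vfield \<Rightarrow> vfield"
  where "nabla_f nabla f X Y = nabla X (tensor_apply f Y) - tensor_apply f (nabla X Y)"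

text \<open>In the following, \<open>nabla\<close> is meant to be the Levi-Civita connection of \<open>g\<close>.\<close>

definition kaehler_f_structure :: "metric \<Rightarrow> connection \<Rightarrow> tensor11 \<Rightarrow> bool"
  where "kaehler_f_structure g nabla f \<longleftrightarrow> metric_f_structure g f \<and>
    (\<forall>X\<in>vector_fields. \<forall>Y\<in>vector_fields. nabla_f nabla f X Y = 0)"

definition killing_f_structure :: "metric \<Rightarrow> connection \<Rightarrow> tensor11 \<Rightarrow> bool"
  where "killing_f_structure g nabla f \<longleftrightarrow> metric_f_structure g f \<and>
    (\<forall>X\<in>vector_fields. nabla_f nabla f X X = 0)"

definition strictly_killing_f_structure :: "metric \<Rightarrow> connection \<Rightarrow> tensor11 \<Rightarrow> bool"
  where "strictly_killing_f_structure g nabla f \<longleftrightarrow>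
    killing_f_structure g nabla f \<and> \<not> kaehler_f_structure g nabla f"

end

theory Submission
  imports Defs
begin

text \<open>
  Write \<open>A\<^sup>*\<close> for the fundamental vector field of \<open>A \<in> su(3)\<close>. A flag is determined by the projections
  \<open>P\<^sub>j\<close> onto its three lines, and a vector field \<open>X\<close> agrees at each point with the fundamental field of
  \<open>1/2 \<Sum>\<^sub>j [X P\<^sub>j, P\<^sub>j]\<close>. Hence every vector field is a combination of fundamental fields with smooth
  global coefficients, and tensoriality needs no cut-off functions.

  Since \<open>f\<close> is invariant, \<open>[A\<^sup>*, fB\<^sup>*] = f[A\<^sup>*, B\<^sup>*]\<close>, so the connection being torsion free,
  \<open>(\<nabla>\<^bsub>A\<^sup>*\<^esub> f) B\<^sup>* = \<nabla>\<^bsub>fB\<^sup>*\<^esub> A\<^sup>* - f \<nabla>\<^bsub>B\<^sup>*\<^esub> A\<^sup>*\<close>, where the Koszul formula gives the right-hand side in terms of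
  the Lie bracket. For \<open>g = (l\<^sub>1, l\<^sub>2, l\<^sub>3)\<close>, \<open>f = (z\<^sub>1, z\<^sub>2, z\<^sub>3)\<close> and \<open>u\<^sub>i = (l\<^sub>j + l\<^sub>k - l\<^sub>i) (z\<^sub>j + z\<^sub>k)\<close> with
  \<open>{i, j, k} = {1, 2, 3}\<close> this yields that \<open>f\<close> is Kaehler iff all \<open>u\<^sub>i\<close> vanish, and Killing iff they are
  equal. The rest is arithmetic with \<open>z\<^sub>i \<in> {-1, 0, 1}\<close> and \<open>l\<^sub>i > 0\<close>.
\<close>

section \<open>Smooth functions on open sets\<close>

text \<open>The connection is only given abstractly on global fields, and a tangent vector only
  through derivatives of functions along some curve. Everything therefore has to be brought back to
  matrices without charts. At \<open>proj x\<close> generators are moved to a left frame, in which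
  an invariant tensor has the same constant coefficients as at the base point.

  The shape of the u_i comes from the torus weights: the commutator sends two different root spaces
  into the third, so the covariant derivative of f is a trilinear form in A, B, C that only combines
  entries from three different root spaces. Its coefficient is u_i when the direction A lies in the
  i-th one. These three pieces can be tested separately, which gives the Kaehler condition. For B =
  A the three pieces without their coefficients add up to zero identically, so only the differences
  of the u_i are visible, which gives the Killing condition.\<close>

lemma C_k_on_cong:
  assumes "open U" "\<And>x. x \<in> U \<Longrightarrow> F x = G x" "C_k_on n F U"
  shows "C_k_on n G U"
  using assms(2,3)
proof (induction n arbitrary: F G)
  case 0
  then show ?case by (simp cong: continuous_on_cong)
next
  case (Suc n)
  have diff: "G differentiable (at x)" if "x \<in> U" for x
  proof -
    have "(F has_derivative frechet_derivative F (at x)) (at x)"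
      using Suc.prems that by (simp add: frechet_derivative_works)
    from has_derivative_transform_within_open[OF this assms(1) that] Suc.prems(1)
    show ?thesis by (auto simp: differentiable_def)
  qed
  have "frechet_derivative F (at x) v = frechet_derivative G (at x) v" if "x \<in> U" for x v
    using frechet_derivative_transform_within_open[of F x U G] Suc.prems that assms(1) by auto
  then have "C_k_on n (\<lambda>x. frechet_derivative G (at x) v) U" for v
    using Suc.IH[of "\<lambda>x. frechet_derivative F (at x) v" "\<lambda>x. frechet_derivative G (at x) v"] Suc.prems
    by auto
  with diff show ?case by auto
qed

lemma C_k_on_Suc_imp: "C_k_on (Suc n) F U \<Longrightarrow> C_k_on n F U"
proof (induction n arbitrary: F)
  case 0
  then show ?case
    by (auto intro!: continuous_at_imp_continuous_on differentiable_imp_continuous_within)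
next
  case (Suc n)
  then show ?case by (metis C_k_on.simps(2))
qed

lemma C_k_on_subset: "V \<subseteq> U \<Longrightarrow> C_k_on n F U \<Longrightarrow> C_k_on n F V"
  by (induction n arbitrary: F) (auto intro: continuous_on_subset)

lemma C_k_on_const: "C_k_on n (\<lambda>x. c) U"
  by (induction n arbitrary: c) auto

lemma C_k_on_bounded_linear:
  assumes "bounded_linear F" shows "C_k_on n F U"
proof (cases n)
  case 0
  then show ?thesis using assms by (simp add: linear_continuous_on)
next
  case (Suc m)
  have "frechet_derivative F (at x) = F" for x
    using assms bounded_linear_imp_has_derivative frechet_derivative_at by metis
  with Suc show ?thesis
    using assms by (simp add: C_k_on_const bounded_linear_imp_differentiable)
qed

lemma C_k_on_add:
  assumes "open U" "C_k_on n F U" "C_k_on n G U"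
  shows "C_k_on n (\<lambda>x. F x + G x) U"
  using assms(2,3)
proof (induction n arbitrary: F G)
  case 0
  then show ?case by (auto intro: continuous_intros)
next
  case (Suc n)
  have eq: "frechet_derivative (\<lambda>x. F x + G x) (at x)
      = (\<lambda>v. frechet_derivative F (at x) v + frechet_derivative G (at x) v)" if "x \<in> U" for x
    using Suc.prems that
    by (intro frechet_derivative_at[symmetric] has_derivative_add)
      (auto simp: frechet_derivative_works[symmetric])
  have "C_k_on n (\<lambda>x. frechet_derivative F (at x) v + frechet_derivative G (at x) v) U" for v
    using Suc by auto
  then have "C_k_on n (\<lambda>x. frechet_derivative (\<lambda>x. F x + G x) (at x) v) U" for v
    by (rule C_k_on_cong[OF assms(1), rotated]) (simp add: eq)
  then show ?case using Suc.prems by auto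
qed

lemma C_k_on_mult:
  assumes "open U" "C_k_on n F U" "C_k_on n G U"
  shows "C_k_on n (\<lambda>x. F x * G x) U"
  using assms(2,3)
proof (induction n arbitrary: F G)
  case 0
  then show ?case by (auto intro: continuous_intros)
next
  case (Suc n)
  have eq: "frechet_derivative (\<lambda>x. F x * G x) (at x)
      = (\<lambda>v. F x * frechet_derivative G (at x) v + frechet_derivative F (at x) v * G x)"
    if "x \<in> U" for x
    using Suc.prems that
    by (intro frechet_derivative_at[symmetric] has_derivative_mult)
      (auto simp: frechet_derivative_works[symmetric])
  \<comment> \<open>The product rule keeps one factor undifferentiated, so both factors are needed
    at the lower order too.\<close>
  have "C_k_on n F U" "C_k_on n G U"
    using Suc.prems C_k_on_Suc_imp by auto
  then have "C_k_on n (\<lambda>x. F x * frechet_derivative G (at x) v + frechet_derivative F (at x) v * G x) U" for v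
    using Suc by (intro C_k_on_add assms(1) Suc.IH) auto
  then have "C_k_on n (\<lambda>x. frechet_derivative (\<lambda>x. F x * G x) (at x) v) U" for v
    by (rule C_k_on_cong[OF assms(1), rotated]) (simp add: eq)
  then show ?case using Suc.prems by auto
qed

lemma C_k_on_compose_linear:
  assumes "open U" "bounded_linear T" "C_k_on n F U"
  shows "C_k_on n (\<lambda>x. F (T x)) (T -` U)"
  using assms(3)
proof (induction n arbitrary: F)
  case 0
  then show ?case
    using continuous_on_compose2[of U F "T -` U" T] linear_continuous_on[OF assms(2)] by auto
next
  case (Suc n)
  have der: "((\<lambda>x. F (T x)) has_derivative (\<lambda>v. frechet_derivative F (at (T x)) (T v))) (at x)"
    if "T x \<in> U" for x
    using Suc.prems that assms(2)
    by (intro has_derivative_compose[of T T x UNIV F] bounded_linear_imp_has_derivative)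
      (auto simp: frechet_derivative_works[symmetric])
  have eq: "frechet_derivative (\<lambda>x. F (T x)) (at x) v = frechet_derivative F (at (T x)) (T v)"
    if "T x \<in> U" for x v
    using frechet_derivative_at[OF der[OF that]] by metis
  have op: "open (T -` U)"
    by (rule open_vimage[OF assms(1) linear_continuous_on[OF assms(2)]])
  have "C_k_on n (\<lambda>x. frechet_derivative F (at (T x)) (T v)) (T -` U)" for v
    using Suc.IH[of "\<lambda>x. frechet_derivative F (at x) (T v)"] Suc.prems by simp
  then have "C_k_on n (\<lambda>x. frechet_derivative (\<lambda>x. F (T x)) (at x) v) (T -` U)" for v
    by (rule C_k_on_cong[OF op, rotated]) (simp add: eq)
  then show ?case using der by (auto simp: differentiable_def)
qed

lemma C_infinity_on_bounded_linear: "bounded_linear F \<Longrightarrow> C_infinity_on F U"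
  by (simp add: C_infinity_on_def C_k_on_bounded_linear)

lemma C_infinity_on_compose_linear:
  "open U \<Longrightarrow> bounded_linear T \<Longrightarrow> C_infinity_on F U \<Longrightarrow> C_infinity_on (\<lambda>x. F (T x)) (T -` U)"
  by (simp add: C_infinity_on_def C_k_on_compose_linear)

lemma C_infinity_on_const: "C_infinity_on (\<lambda>x. c) U"
  by (simp add: C_infinity_on_def C_k_on_const)

lemma C_infinity_on_add:
  "open U \<Longrightarrow> C_infinity_on F U \<Longrightarrow> C_infinity_on G U \<Longrightarrow> C_infinity_on (\<lambda>x. F x + G x) U"
  by (simp add: C_infinity_on_def C_k_on_add)

lemma C_infinity_on_mult:
  "open U \<Longrightarrow> C_infinity_on F U \<Longrightarrow> C_infinity_on G U \<Longrightarrow> C_infinity_on (\<lambda>x. F x * G x) U"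
  by (simp add: C_infinity_on_def C_k_on_mult)

lemma C_infinity_on_sum:
  assumes "open U" "\<And>i. i \<in> I \<Longrightarrow> C_infinity_on (F i) U"
  shows "C_infinity_on (\<lambda>x. \<Sum>i\<in>I. F i x) U"
  using assms(2)
  by (induction I rule: infinite_finite_induct)
    (auto intro: C_infinity_on_const C_infinity_on_add assms(1))

lemma C_infinity_on_subset: "V \<subseteq> U \<Longrightarrow> C_infinity_on F U \<Longrightarrow> C_infinity_on F V"
  by (meson C_infinity_on_def C_k_on_subset)

lemma C_infinity_on_differentiable:
  "C_infinity_on F U \<Longrightarrow> x \<in> U \<Longrightarrow> F differentiable (at x)"
  by (metis C_infinity_on_def C_k_on.simps(2))

lemma C_infinity_on_derivative:
  "C_infinity_on F U \<Longrightarrow> C_infinity_on (\<lambda>x. frechet_derivative F (at x) v) U"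
  by (metis C_infinity_on_def C_k_on.simps(2))

lemma C_infinity_on_cong:
  "open U \<Longrightarrow> (\<And>x. x \<in> U \<Longrightarrow> F x = G x) \<Longrightarrow> C_infinity_on F U \<Longrightarrow> C_infinity_on G U"
  by (meson C_infinity_on_def C_k_on_cong)

text \<open>\<open>C_k_on\<close> speaks of fixed directions only, while a fundamental field
  differentiates at \<open>y\<close> in the direction \<open>A ** y\<close>. Expanding the moving
  direction in a basis reduces it to fixed ones with linear coefficients.\<close>

lemma C_infinity_on_derivative_linear:
  fixes F :: "'a::euclidean_space \<Rightarrow> real"
  assumes "open U" "C_infinity_on F U" "bounded_linear T"
  shows "C_infinity_on (\<lambda>x. frechet_derivative F (at x) (T x)) U"
proof -
  have eq: "(\<Sum>b\<in>Basis. (T x \<bullet> b) * frechet_derivative F (at x) b) = frechet_derivative F (at x) (T x)"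
    if "x \<in> U" for x
  proof -
    interpret linear "frechet_derivative F (at x)"
      using C_infinity_on_differentiable[OF assms(2) that] linear_frechet_derivative by blast
    have "frechet_derivative F (at x) (\<Sum>b\<in>Basis. (T x \<bullet> b) *\<^sub>R b)
        = (\<Sum>b\<in>Basis. (T x \<bullet> b) * frechet_derivative F (at x) b)"
      by (simp add: sum scale)
    then show ?thesis by (simp only: euclidean_representation)
  qed
  have "C_infinity_on (\<lambda>x. \<Sum>b\<in>Basis. (T x \<bullet> b) * frechet_derivative F (at x) b) U"
  proof (rule C_infinity_on_sum[OF assms(1)])
    fix b :: 'a
    have "C_infinity_on (\<lambda>x. T x \<bullet> b) U"
      using assms(3) by (intro C_infinity_on_bounded_linear bounded_linear_inner_left_comp)
    then show "C_infinity_on (\<lambda>x. (T x \<bullet> b) * frechet_derivative F (at x) b) U"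
      by (rule C_infinity_on_mult[OF assms(1) _ C_infinity_on_derivative[OF assms(2)]])
  qed
  from C_infinity_on_cong[OF assms(1) eq this] show ?thesis .
qed

section \<open>Matrices\<close>

lemma has_vector_derivative_vec:
  fixes f :: "real \<Rightarrow> 'a::euclidean_space ^ 'n"
  assumes "\<And>i. ((\<lambda>t. f t $ i) has_vector_derivative V $ i) (at x within S)"
  shows "(f has_vector_derivative V) (at x within S)"
  unfolding has_vector_derivative_def
proof (subst has_derivative_componentwise_within, rule ballI)
  fix b :: "'a ^ 'n" assume "b \<in> Basis"
  then obtain i u where b: "b = axis i u" "u \<in> Basis" by (auto simp: Basis_vec_def)
  have "((\<lambda>t. f t $ i \<bullet> u) has_derivative (\<lambda>t. (t *\<^sub>R V $ i) \<bullet> u)) (at x within S)"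
    using assms[of i] unfolding has_vector_derivative_def by (intro has_derivative_inner_left)
  then show "((\<lambda>t. f t \<bullet> b) has_derivative (\<lambda>t. (t *\<^sub>R V) \<bullet> b)) (at x within S)"
    by (simp add: b inner_axis)
qed

lemma has_vector_derivative_vec_nth:
  "(f has_vector_derivative V) F \<Longrightarrow> ((\<lambda>t. f t $ i) has_vector_derivative V $ i) F"
  by (rule bounded_linear.has_vector_derivative[OF bounded_linear_vec_nth])

lemma mult_nth_3: "(A ** B) $ i $ j = A $ i $ 1 * B $ 1 $ j + A $ i $ 2 * B $ 2 $ j + A $ i $ 3 * B $ 3 $ j"
  for A B :: mat3
  by (simp add: matrix_matrix_mult_def sum_3)

lemma mult_scaleR_left: "(c *\<^sub>R A) ** B = c *\<^sub>R (A ** B)" for A B :: mat3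
  by (simp add: vec_eq_iff mult_nth_3 scaleR_add_right)

lemma mult_scaleR_right: "A ** (c *\<^sub>R B) = c *\<^sub>R (A ** B)" for A B :: mat3
  by (simp add: vec_eq_iff mult_nth_3 scaleR_add_right)

lemma mult_minus_left: "(- A) ** B = - (A ** B)" for A B :: mat3
  by (simp add: vec_eq_iff mult_nth_3)

lemma mult_minus_right: "A ** (- B) = - (A ** B)" for A B :: mat3
  by (simp add: vec_eq_iff mult_nth_3)

lemma mult_add_left: "(A + B) ** C = A ** C + B ** C" for A B C :: mat3
  by (simp add: vec_eq_iff mult_nth_3 algebra_simps)

lemma bounded_bilinear_mat3: "bounded_bilinear ((**) :: mat3 \<Rightarrow> mat3 \<Rightarrow> mat3)"
  unfolding bilinear_conv_bounded_bilinear[symmetric] bilinear_def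
  by (auto intro!: linearI simp: matrix_add_ldistrib mult_add_left mult_scaleR_left mult_scaleR_right)

lemmas mat3_linear_left = bounded_bilinear.bounded_linear_left[OF bounded_bilinear_mat3]
lemmas mat3_linear_right = bounded_bilinear.bounded_linear_right[OF bounded_bilinear_mat3]
lemmas has_vector_derivative_mat3_mult = bounded_bilinear.has_vector_derivative[OF bounded_bilinear_mat3]

section \<open>Adjoints, the special unitary group and its Lie algebra\<close>

definition adj :: "mat3 \<Rightarrow> mat3"
  where "adj A = map_matrix cnj (transpose A)"

lemma adj_nth [simp]: "adj A $ i $ j = cnj (A $ j $ i)"
  by (simp add: adj_def transpose_def)

lemma adj_add: "adj (A + B) = adj A + adj B" by (simp add: vec_eq_iff)
lemma adj_diff: "adj (A - B) = adj A - adj B" by (simp add: vec_eq_iff)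
lemma adj_scaleR: "adj (c *\<^sub>R A) = c *\<^sub>R adj A" by (simp add: vec_eq_iff)
lemma adj_adj [simp]: "adj (adj A) = A" by (simp add: vec_eq_iff)
lemma adj_mat_1 [simp]: "adj (mat 1) = mat 1" by (simp add: vec_eq_iff mat_def)
lemma adj_mult: "adj (A ** B) = adj B ** adj A" by (simp add: vec_eq_iff mult_nth_3 algebra_simps)

lemma bounded_linear_adj: "bounded_linear adj"
  by (intro linear_conv_bounded_linear[THEN iffD1] linearI adj_add adj_scaleR)

lemma det_adj: "det (adj A) = cnj (det A)"
  by (simp add: det_3 algebra_simps)

lemma SU3_iff: "x \<in> SU3 \<longleftrightarrow> x ** adj x = mat 1 \<and> det x = 1"
  by (simp add: SU3_def adj_def)

lemma SU3_mult_adj [simp]: "x \<in> SU3 \<Longrightarrow> x ** adj x = mat 1"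
  by (simp add: SU3_iff)

lemma SU3_adj_mult [simp]: "x \<in> SU3 \<Longrightarrow> adj x ** x = mat 1"
  using SU3_mult_adj matrix_left_right_inverse by blast

lemma SU3_det: "x \<in> SU3 \<Longrightarrow> det x = 1"
  by (simp add: SU3_iff)

lemma SU3_mult_adj_assoc [simp]: "x \<in> SU3 \<Longrightarrow> x ** (adj x ** B) = B"
  by (simp add: matrix_mul_assoc)

lemma SU3_adj_mult_assoc [simp]: "x \<in> SU3 \<Longrightarrow> adj x ** (x ** B) = B"
  by (simp add: matrix_mul_assoc)

lemma SU3_1 [simp]: "mat 1 \<in> SU3"
  by (simp add: SU3_iff)

lemma SU3_adj [simp]: "x \<in> SU3 \<Longrightarrow> adj x \<in> SU3"
  by (simp add: SU3_iff[of "adj x"] det_adj SU3_det)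

lemma SU3_mult [simp]: "x \<in> SU3 \<Longrightarrow> y \<in> SU3 \<Longrightarrow> x ** y \<in> SU3"
  by (simp add: SU3_iff[of "x ** y"] adj_mult det_mul SU3_det matrix_mul_assoc[symmetric])

text \<open>On \<open>SU3\<close> this is Ad of the inverse of \<open>x\<close>. It is chosen so
  that \<open>A ** x = x ** conjugate x A\<close>, which turns a left generator into a right
  one.\<close>

definition conjugate :: "mat3 \<Rightarrow> mat3 \<Rightarrow> mat3"
  where "conjugate x B = adj x ** B ** x"

definition commutator :: "mat3 \<Rightarrow> mat3 \<Rightarrow> mat3"
  where "commutator A B = A ** B - B ** A"

definition su3 :: "mat3 set"
  where "su3 = {A. adj A = - A \<and> trace A = 0}"

lemma conjugate_linear: "bounded_linear (conjugate x)"
  unfolding conjugate_def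
  by (intro linear_conv_bounded_linear[THEN iffD1] linearI)
    (simp_all add: matrix_add_ldistrib mult_add_left mult_scaleR_left mult_scaleR_right)

lemmas conjugate_add = linear_add[OF bounded_linear.linear[OF conjugate_linear]]
lemmas conjugate_scaleR = linear_scale[OF bounded_linear.linear[OF conjugate_linear]]
lemmas conjugate_diff = linear_diff[OF bounded_linear.linear[OF conjugate_linear]]
lemmas conjugate_minus = linear_neg[OF bounded_linear.linear[OF conjugate_linear]]

lemma conjugate_1 [simp]: "conjugate (mat 1) B = B"
  by (simp add: conjugate_def)

lemma conjugate_mult: "conjugate (x ** y) B = conjugate y (conjugate x B)"
  by (simp add: conjugate_def adj_mult matrix_mul_assoc)

lemma conjugate_conjugate_adj [simp]: "x \<in> SU3 \<Longrightarrow> conjugate x (conjugate (adj x) B) = B"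
  "x \<in> SU3 \<Longrightarrow> conjugate (adj x) (conjugate x B) = B"
  by (simp_all flip: conjugate_mult)

lemma conjugate_commutator: "x \<in> SU3 \<Longrightarrow> conjugate x (commutator A B) = commutator (conjugate x A) (conjugate x B)"
proof -
  assume x: "x \<in> SU3"
  have "adj x ** A ** B ** x = conjugate x A ** conjugate x B" for A B
    using x by (simp add: conjugate_def matrix_mul_assoc[symmetric])
  then show ?thesis
    by (simp add: commutator_def conjugate_diff) (simp add: conjugate_def matrix_mul_assoc)
qed

lemma commutator_add_left: "commutator (A + A') B = commutator A B + commutator A' B"
  by (simp add: commutator_def matrix_add_ldistrib mult_add_left)

lemma commutator_add_right: "commutator A (B + B') = commutator A B + commutator A B'"
  by (simp add: commutator_def matrix_add_ldistrib mult_add_left)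

lemma commutator_scaleR_left: "commutator (c *\<^sub>R A) B = c *\<^sub>R commutator A B"
  by (simp add: commutator_def mult_scaleR_left mult_scaleR_right scaleR_diff_right)

lemma commutator_scaleR_right: "commutator A (c *\<^sub>R B) = c *\<^sub>R commutator A B"
  by (simp add: commutator_def mult_scaleR_left mult_scaleR_right scaleR_diff_right)

lemma commutator_minus_swap: "- commutator A B = commutator B A"
  by (simp add: commutator_def)

lemma su3_add [simp]: "A \<in> su3 \<Longrightarrow> B \<in> su3 \<Longrightarrow> A + B \<in> su3"
  by (simp add: su3_def adj_add trace_add)

lemma su3_scaleR [simp]: "A \<in> su3 \<Longrightarrow> c *\<^sub>R A \<in> su3"
  by (simp add: su3_def adj_scaleR) (simp add: trace_def scaleR_sum_right[symmetric])

lemma su3_minus [simp]: "A \<in> su3 \<Longrightarrow> - A \<in> su3"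
  using su3_scaleR[of A "-1"] by simp

lemma su3_diff [simp]: "A \<in> su3 \<Longrightarrow> B \<in> su3 \<Longrightarrow> A - B \<in> su3"
  using su3_add[of A "- B"] by simp

lemma su3_0 [simp]: "0 \<in> su3"
  using su3_diff[of "0" "0"] by (simp add: su3_def adj_def vec_eq_iff trace_def transpose_def)

lemma su3_commutator [simp]: "A \<in> su3 \<Longrightarrow> B \<in> su3 \<Longrightarrow> commutator A B \<in> su3"
  by (simp add: su3_def commutator_def adj_diff adj_mult mult_minus_left mult_minus_right trace_sub trace_mul_sym[of A])

lemma su3_conjugate [simp]: "x \<in> SU3 \<Longrightarrow> A \<in> su3 \<Longrightarrow> conjugate x A \<in> su3"
  by (simp add: su3_def conjugate_def adj_mult mult_minus_left mult_minus_right matrix_mul_assoc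
      trace_mul_sym[of "adj x ** A" x] )

lemma D_nth [simp]:
  "D a b c $ 1 $ 1 = 0" "D a b c $ 1 $ 2 = a" "D a b c $ 1 $ 3 = cnj c"
  "D a b c $ 2 $ 1 = - cnj a" "D a b c $ 2 $ 2 = 0" "D a b c $ 2 $ 3 = b"
  "D a b c $ 3 $ 1 = - c" "D a b c $ 3 $ 2 = - cnj b" "D a b c $ 3 $ 3 = 0"
  by (simp_all add: D_def)

lemma su3_D [simp]: "D a b c \<in> su3"
  by (simp add: su3_def trace_def sum_3 vec_eq_iff forall_3)

text \<open>The entries (1,2), (2,3), (3,1) are kept as independent coordinates. This cyclic choice
  matches \<open>D\<close>, whose third parameter is minus the (3,1) entry.\<close>

lemma su3_nth:
  assumes "A \<in> su3"
  shows "A $ 2 $ 1 = - cnj (A $ 1 $ 2)" "A $ 3 $ 2 = - cnj (A $ 2 $ 3)" "A $ 1 $ 3 = - cnj (A $ 3 $ 1)"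
    "Re (A $ i $ i) = 0" "A $ 3 $ 3 = - A $ 1 $ 1 - A $ 2 $ 2"
proof -
  have "adj A $ i $ j = (- A) $ i $ j" for i j using assms by (simp add: su3_def)
  then have *: "cnj (A $ j $ i) = - A $ i $ j" for i j by simp
  show "A $ 2 $ 1 = - cnj (A $ 1 $ 2)" "A $ 3 $ 2 = - cnj (A $ 2 $ 3)" "A $ 1 $ 3 = - cnj (A $ 3 $ 1)"
    using * by simp_all
  show "Re (A $ i $ i) = 0" using arg_cong[OF *[of i i], of Re] by simp
  show "A $ 3 $ 3 = - A $ 1 $ 1 - A $ 2 $ 2"
    using assms by (simp add: su3_def trace_def sum_3 algebra_simps add_eq_0_iff)
qed

lemma Tmax_SU3: "t \<in> Tmax \<Longrightarrow> t \<in> SU3"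
  by (simp add: Tmax_def)

section \<open>Curves in the special unitary group\<close>

text \<open>The functions \<open>x ** adj x\<close> and \<open>det\<close> are constant along the
  curve; their derivatives at the identity are \<open>A + adj A\<close> and
  \<open>trace A\<close>.\<close>

lemma SU3_curve_velocity:
  assumes "\<And>t. \<gamma> t \<in> SU3" "\<gamma> 0 = mat 1" "(\<gamma> has_vector_derivative A) (at (0::real))"
  shows "A \<in> su3"
proof -
  have "((\<lambda>t. \<gamma> t ** adj (\<gamma> t)) has_vector_derivative \<gamma> 0 ** adj A + A ** adj (\<gamma> 0)) (at 0)"
    by (intro has_vector_derivative_mat3_mult bounded_linear.has_vector_derivative[OF bounded_linear_adj] assms)
  moreover have "((\<lambda>t. \<gamma> t ** adj (\<gamma> t)) has_vector_derivative 0) (at 0)"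
    using assms(1) by simp
  ultimately have "\<gamma> 0 ** adj A + A ** adj (\<gamma> 0) = 0"
    by (rule vector_derivative_unique_at)
  then have adj: "adj A = - A"
    using assms(2) by (simp add: add_eq_0_iff2)
  have 1: "((\<lambda>t. \<gamma> t $ i $ j) has_vector_derivative A $ i $ j) (at 0)" for i j
    by (intro has_vector_derivative_vec_nth assms)
  have "((\<lambda>t. det (\<gamma> t)) has_vector_derivative trace A) (at 0)"
    unfolding det_3
    by (auto intro!: derivative_eq_intros 1 simp: assms(2) mat_def trace_def sum_3)
  moreover have "((\<lambda>t. det (\<gamma> t)) has_vector_derivative 0) (at 0)"
    using assms(1) by (simp add: SU3_det)
  ultimately have "trace A = 0"
    by (rule vector_derivative_unique_at)
  with adj show ?thesis by (simp add: su3_def)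
qed

text \<open>A substitute for the exponential curve: only value and velocity at 0 matter, and
  velocities add under products. Membership in \<open>SU3\<close> at all times is what
  \<open>dproj\<close> asks of its curves.\<close>

definition su3_curve :: "(real \<Rightarrow> mat3) \<Rightarrow> mat3 \<Rightarrow> bool"
  where "su3_curve \<gamma> A \<longleftrightarrow>
    (\<forall>t. \<gamma> t \<in> SU3) \<and> \<gamma> 0 = mat 1 \<and> (\<gamma> has_vector_derivative A) (at 0)"

lemma su3_curve_add:
  assumes "su3_curve \<gamma> A" "su3_curve \<delta> B"
  shows "su3_curve (\<lambda>t. \<gamma> t ** \<delta> t) (A + B)"
  using assms has_vector_derivative_mat3_mult[of \<gamma> A 0 UNIV \<delta> B]
  by (simp add: su3_curve_def add.commute)

lemma su3_curve_conjugate: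
  assumes "x \<in> SU3" "su3_curve \<gamma> A"
  shows "su3_curve (\<lambda>t. conjugate x (\<gamma> t)) (conjugate x A)"
  using assms bounded_linear.has_vector_derivative[OF conjugate_linear, of \<gamma> A "at 0"]
  by (simp add: su3_curve_def) (simp add: conjugate_def)

definition diag_su3 :: "real \<Rightarrow> real \<Rightarrow> mat3"
  where "diag_su3 r s = vector [vector [\<i> * r, 0, 0], vector [0, \<i> * s, 0], vector [0, 0, - (\<i> * (r + s))]]"

text \<open>Staying inside \<open>Tmax\<close> makes the projected curve constant, which is why
  diagonal generators give the zero tangent vector.\<close>

lemma su3_curve_diag_su3: "\<exists>\<gamma>. su3_curve \<gamma> (diag_su3 r s) \<and> (\<forall>t. \<gamma> t \<in> Tmax)"
proof -
  define \<gamma> where "\<gamma> t = (vector [vector [cis (r * t), 0, 0], vector [0, cis (s * t), 0],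
    vector [0, 0, cis (- (r + s) * t)]] :: mat3)" for t
  have T: "\<gamma> t \<in> Tmax" for t
    by (simp add: Tmax_def SU3_iff \<gamma>_def vec_eq_iff forall_3 mult_nth_3 mat_def cis_cnj cis_mult
        det_3 algebra_simps)
  have cis: "((\<lambda>t. cis (a * t)) has_vector_derivative \<i> * a) (at 0)" for a :: real
  proof -
    have "((\<lambda>t. cos (a * t)) has_real_derivative 0) (at 0)" "((\<lambda>t. sin (a * t)) has_real_derivative a) (at 0)"
      by (auto intro!: derivative_eq_intros)
    from has_vector_derivative_add[OF has_vector_derivative_of_real[OF this(1), where ?'a = complex]
        has_vector_derivative_mult_right[OF has_vector_derivative_of_real[OF this(2)], of \<i>]]
    have "((\<lambda>t. complex_of_real (cos (a * t)) + \<i> * of_real (sin (a * t))) has_vector_derivative \<i> * a) (at 0)"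
      by simp
    moreover have "complex_of_real (cos u) + \<i> * of_real (sin u) = cis u" for u
      by (simp add: complex_eq_iff)
    ultimately show ?thesis by simp
  qed
  have "((\<lambda>t. \<gamma> t $ i $ j) has_vector_derivative diag_su3 r s $ i $ j) (at 0)" for i j
    using exhaust_3[of i] exhaust_3[of j] cis[of r] cis[of s] cis[of "- (r + s)"]
    by (auto simp: \<gamma>_def diag_su3_def algebra_simps)
  then have "(\<gamma> has_vector_derivative diag_su3 r s) (at 0)" by (intro has_vector_derivative_vec)
  moreover have "\<gamma> 0 = mat 1" by (simp add: \<gamma>_def vec_eq_iff forall_3 mat_def)
  ultimately show ?thesis
    using T Tmax_SU3 by (auto simp: su3_curve_def)
qed

text \<open>The first two rows of \<open>mat 1 + t *\<^sub>R D a 0 0\<close> are orthogonal and of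
  equal length; dividing them by this length lands in \<open>SU3\<close>. The factor
  \<open>n t\<close> is 1 up to second order, so the velocity is unaffected.\<close>

lemma su3_curve_D1: "\<exists>\<gamma>. su3_curve \<gamma> (D a 0 0)"
proof -
  define n where "n t = 1 / sqrt (1 + t\<^sup>2 * (cmod a)\<^sup>2)" for t :: real
  define \<gamma> where "\<gamma> t = (vector [vector [n t, n t * t * a, 0],
    vector [- (n t * t * cnj a), n t, 0], vector [0, 0, 1]] :: mat3)" for t :: real
  have n: "n t * n t * (1 + t\<^sup>2 * (cmod a)\<^sup>2) = 1" for t
  proof -
    have "1 + t\<^sup>2 * (cmod a)\<^sup>2 > 0" by (smt (verit) zero_le_mult_iff zero_le_power2)
    then show ?thesis by (simp add: n_def)
  qed
  have n': "complex_of_real (n t) * n t + n t * t * a * (n t * t * cnj a) = 1" for t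
  proof -
    have "complex_of_real (n t) * n t + n t * t * a * (n t * t * cnj a)
      = of_real (n t * n t) + of_real (n t * n t * t\<^sup>2) * (a * cnj a)"
      by (simp add: power2_eq_square)
    also have "\<dots> = of_real (n t * n t * (1 + t\<^sup>2 * (cmod a)\<^sup>2))"
      unfolding complex_norm_square[symmetric] by (simp add: algebra_simps)
    finally show ?thesis by (simp add: n)
  qed
  have "\<gamma> t \<in> SU3" for t
    using n'[of t]
    by (simp add: SU3_iff \<gamma>_def vec_eq_iff forall_3 mult_nth_3 mat_def det_3 algebra_simps)
  moreover have "\<gamma> 0 = mat 1"
    by (simp add: \<gamma>_def n_def vec_eq_iff forall_3 mat_def)
  moreover have "(\<gamma> has_vector_derivative D a 0 0) (at 0)"
  proof -
    have "(n has_real_derivative 0) (at 0)"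
      unfolding n_def by (auto intro!: derivative_eq_intros)
    from has_vector_derivative_of_real[OF this]
    have n1: "((\<lambda>t. complex_of_real (n t)) has_vector_derivative 0) (at 0)" by simp
    have n2: "((\<lambda>t. complex_of_real (n t) * t * b) has_vector_derivative b) (at 0)" for b
      using has_vector_derivative_mult_left[OF
          has_vector_derivative_mult[OF n1 has_vector_derivative_of_real[OF DERIV_ident]], of b]
      by (simp add: n_def)
    have "((\<lambda>t. \<gamma> t $ i $ j) has_vector_derivative D a 0 0 $ i $ j) (at 0)" for i j
      using exhaust_3[of i] exhaust_3[of j] n1 n2[of a] has_vector_derivative_minus[OF n2[of "cnj a"]]
      by (auto simp: \<gamma>_def)
    then show ?thesis by (intro has_vector_derivative_vec)
  qed
  ultimately show ?thesis by (auto simp: su3_curve_def)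
qed

lemma su3_decomp:
  assumes "A \<in> su3"
  shows "A = diag_su3 (Im (A $ 1 $ 1)) (Im (A $ 2 $ 2)) + D (A $ 1 $ 2) (A $ 2 $ 3) (- A $ 3 $ 1)"
  using su3_nth[OF assms] by (simp add: diag_su3_def vec_eq_iff forall_3 complex_eq_iff)

lemma su3_curve_exists:
  assumes "A \<in> su3" shows "\<exists>\<gamma>. su3_curve \<gamma> A"
proof -
  \<comment> \<open>A cyclic permutation matrix has determinant 1, and conjugation by it permutes
    the three root spaces. The sign below stems from the minus in front of the third parameter of
    \<open>D\<close>.\<close>
  define P :: mat3 where "P = vector [vector [0, 0, 1], vector [1, 0, 0], vector [0, 1, 0]]"
  have P: "P \<in> SU3" "P ** P \<in> SU3"
  proof -
    show "P \<in> SU3" 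
      by (simp add: SU3_iff P_def vec_eq_iff forall_3 mult_nth_3 mat_def det_3)
    then show "P ** P \<in> SU3" by simp
  qed
  have "conjugate P (D (- b) 0 0) = D 0 0 b" "conjugate (P ** P) (D b 0 0) = D 0 b 0" for b
    by (simp_all add: conjugate_def P_def vec_eq_iff forall_3 mult_nth_3)
  then have "\<exists>\<gamma>. su3_curve \<gamma> (D 0 0 b)" "\<exists>\<gamma>. su3_curve \<gamma> (D 0 b 0)" for b
    using su3_curve_D1[of b] su3_curve_D1[of "- b"] su3_curve_conjugate P by metis+
  then obtain \<gamma>\<^sub>1 \<gamma>\<^sub>2 \<gamma>\<^sub>3 where "su3_curve \<gamma>\<^sub>1 (D (A $ 1 $ 2) 0 0)" "su3_curve \<gamma>\<^sub>2 (D 0 (A $ 2 $ 3) 0)"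
    "su3_curve \<gamma>\<^sub>3 (D 0 0 (- A $ 3 $ 1))"
    using su3_curve_D1 by metis
  moreover obtain \<gamma>\<^sub>0 where "su3_curve \<gamma>\<^sub>0 (diag_su3 (Im (A $ 1 $ 1)) (Im (A $ 2 $ 2)))"
    using su3_curve_diag_su3 by blast
  ultimately have "\<exists>\<gamma>. su3_curve \<gamma> (diag_su3 (Im (A $ 1 $ 1)) (Im (A $ 2 $ 2)) +
      (D (A $ 1 $ 2) 0 0 + (D 0 (A $ 2 $ 3) 0 + D 0 0 (- A $ 3 $ 1))))"
    using su3_curve_add by blast
  moreover have "D (A $ 1 $ 2) 0 0 + (D 0 (A $ 2 $ 3) 0 + D 0 0 (- A $ 3 $ 1)) = D (A $ 1 $ 2) (A $ 2 $ 3) (- A $ 3 $ 1)"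
    by (simp add: vec_eq_iff forall_3)
  ultimately show ?thesis
    using su3_decomp[OF assms] by auto
qed

lemma su3_curve_diagonal_exists:
  assumes "A \<in> su3" "\<And>i j. i \<noteq> j \<Longrightarrow> A $ i $ j = 0"
  shows "\<exists>\<gamma>. su3_curve \<gamma> A \<and> (\<forall>t. \<gamma> t \<in> Tmax)"
proof -
  have "D (A $ 1 $ 2) (A $ 2 $ 3) (- A $ 3 $ 1) = 0"
    using assms(2) by (simp add: vec_eq_iff forall_3)
  with su3_decomp[OF assms(1)] have "A = diag_su3 (Im (A $ 1 $ 1)) (Im (A $ 2 $ 2))" by simp
  then show ?thesis using su3_curve_diag_su3 by metis
qed

section \<open>The flag manifold as a quotient\<close>

lemma Tmax_1 [simp]: "mat 1 \<in> Tmax"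
  by (simp add: Tmax_def) (simp add: mat_def)

lemma Tmax_adj [simp]: "t \<in> Tmax \<Longrightarrow> adj t \<in> Tmax"
  by (simp add: Tmax_def)

lemma Tmax_mult [simp]: "s \<in> Tmax \<Longrightarrow> t \<in> Tmax \<Longrightarrow> s ** t \<in> Tmax"
  by (auto simp: Tmax_def mult_nth_3 forall_3)

lemma Tmax_nth_unit: "t \<in> Tmax \<Longrightarrow> t $ i $ i * cnj (t $ i $ i) = 1"
proof -
  assume t: "t \<in> Tmax"
  then have "(t ** adj t) $ i $ i = 1" using Tmax_SU3 by (simp add: mat_def)
  then show ?thesis
    using t exhaust_3[of i] by (auto simp: mult_nth_3 Tmax_def)
qed

lemma Rep_flag_proj: "x \<in> SU3 \<Longrightarrow> Rep_flag (proj x) = (\<lambda>t. x ** t) ` Tmax"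
  by (simp add: proj_def Abs_flag_inverse)

lemma proj_mult_Tmax: "x \<in> SU3 \<Longrightarrow> t \<in> Tmax \<Longrightarrow> proj (x ** t) = proj x"
proof -
  assume x: "x \<in> SU3" and t: "t \<in> Tmax"
  have "(\<lambda>s. (x ** t) ** s) ` Tmax = (\<lambda>s. x ** s) ` Tmax"
  proof
    show "(\<lambda>s. (x ** t) ** s) ` Tmax \<subseteq> (\<lambda>s. x ** s) ` Tmax"
      using t by (auto simp: matrix_mul_assoc[symmetric])
    show "(\<lambda>s. x ** s) ` Tmax \<subseteq> (\<lambda>s. (x ** t) ** s) ` Tmax"
    proof
      fix y assume "y \<in> (\<lambda>s. x ** s) ` Tmax"
      then obtain s where "s \<in> Tmax" "y = x ** s" by auto
      then have "y = (x ** t) ** (adj t ** s)" "adj t ** s \<in> Tmax"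
        using t Tmax_SU3[OF t] by (simp_all add: matrix_mul_assoc[symmetric])
      then show "y \<in> (\<lambda>s. (x ** t) ** s) ` Tmax" by auto
    qed
  qed
  then show ?thesis by (simp add: proj_def)
qed

lemma proj_eqD: "x \<in> SU3 \<Longrightarrow> y \<in> SU3 \<Longrightarrow> proj x = proj y \<Longrightarrow> \<exists>t\<in>Tmax. y = x ** t"
proof -
  assume "x \<in> SU3" "y \<in> SU3" "proj x = proj y"
  then have "(\<lambda>t. x ** t) ` Tmax = (\<lambda>t. y ** t) ` Tmax"
    using Rep_flag_proj by metis
  moreover have "y \<in> (\<lambda>t. y ** t) ` Tmax"
    by (rule image_eqI[of _ _ "mat 1"]) simp_all
  ultimately show ?thesis by auto
qed

lemma proj_cases: obtains x where "x \<in> SU3" "p = proj x"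
proof -
  obtain x where "x \<in> SU3" "Rep_flag p = (\<lambda>t. x ** t) ` Tmax" using Rep_flag[of p] by auto
  then have "p = proj x" using Rep_flag_inverse[of p] by (simp add: proj_def)
  with \<open>x \<in> SU3\<close> show thesis by (rule that)
qed

lemma act_proj [simp]: "k \<in> SU3 \<Longrightarrow> x \<in> SU3 \<Longrightarrow> act k (proj x) = proj (k ** x)"
  using Rep_flag_proj[of x] by (simp add: act_def proj_def image_image matrix_mul_assoc)

lemma act_act: "k \<in> SU3 \<Longrightarrow> l \<in> SU3 \<Longrightarrow> act k (act l p) = act (k ** l) p"
  by (cases p rule: proj_cases) (simp add: matrix_mul_assoc)

lemma act_1 [simp]: "act (mat 1) p = p"
  by (cases p rule: proj_cases) simp

text \<open>Evaluates at a chosen representative; the choice is harmless for functions constant on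
  cosets of \<open>Tmax\<close>.\<close>

definition descend :: "(mat3 \<Rightarrow> 'b) \<Rightarrow> flag \<Rightarrow> 'b"
  where "descend h p = h (SOME x. x \<in> SU3 \<and> proj x = p)"

lemma descend_proj:
  assumes "\<And>x t. x \<in> SU3 \<Longrightarrow> t \<in> Tmax \<Longrightarrow> h (x ** t) = h x" "x \<in> SU3"
  shows "descend h (proj x) = h x"
proof -
  define y where "y = (SOME y. y \<in> SU3 \<and> proj y = proj x)"
  have "y \<in> SU3 \<and> proj y = proj x"
    unfolding y_def by (rule someI[of _ x]) (simp add: assms)
  then obtain t where "t \<in> Tmax" "y = x ** t"
    using proj_eqD[of x y] assms(2) by auto
  then show ?thesis
    using assms by (simp add: descend_def y_def[symmetric])
qed

section \<open>Smooth functions on the flag manifold\<close>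

lemma smooth_funI:
  assumes "C_infinity_on F UNIV" "\<And>x. x \<in> SU3 \<Longrightarrow> \<phi> (proj x) = F x"
  shows "smooth_fun \<phi>"
  unfolding smooth_fun_def using assms by (intro ballI exI[of _ UNIV] exI[of _ F]) auto

lemma smooth_funE:
  assumes "smooth_fun \<phi>" "x \<in> SU3"
  obtains U F where "open U" "x \<in> U" "C_infinity_on F U" "\<And>y. y \<in> U \<Longrightarrow> y \<in> SU3 \<Longrightarrow> \<phi> (proj y) = F y"
proof -
  from assms obtain U F where "open U" "x \<in> U" "C_infinity_on F U" "\<forall>y\<in>U \<inter> SU3. \<phi> (proj y) = F y"
    unfolding smooth_fun_def by meson
  then show thesis by (intro that[of U F]) auto
qed

lemma smooth_fun_const [simp]: "smooth_fun (\<lambda>p. c)"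
  by (rule smooth_funI[of "\<lambda>x. c"]) (rule C_infinity_on_const, rule refl)

lemma smooth_fun_add:
  assumes "smooth_fun \<phi>" "smooth_fun \<psi>" shows "smooth_fun (\<lambda>p. \<phi> p + \<psi> p)"
  unfolding smooth_fun_def
proof
  fix x assume x: "x \<in> SU3"
  obtain U F where UF: "open U" "x \<in> U" "C_infinity_on F U" "\<And>y. y \<in> U \<Longrightarrow> y \<in> SU3 \<Longrightarrow> \<phi> (proj y) = F y"
    using smooth_funE[OF assms(1) x] by metis
  obtain V G where VG: "open V" "x \<in> V" "C_infinity_on G V" "\<And>y. y \<in> V \<Longrightarrow> y \<in> SU3 \<Longrightarrow> \<psi> (proj y) = G y"
    using smooth_funE[OF assms(2) x] by metis
  have "C_infinity_on (\<lambda>y. F y + G y) (U \<inter> V)"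
    using UF VG by (intro C_infinity_on_add) (auto intro: C_infinity_on_subset)
  then show "\<exists>U F. open U \<and> x \<in> U \<and> C_infinity_on F U \<and> (\<forall>y\<in>U \<inter> SU3. \<phi> (proj y) + \<psi> (proj y) = F y)"
    using UF VG by (intro exI[of _ "U \<inter> V"] exI[of _ "\<lambda>y. F y + G y"]) auto
qed

lemma smooth_fun_mult:
  assumes "smooth_fun \<phi>" "smooth_fun \<psi>" shows "smooth_fun (\<lambda>p. \<phi> p * \<psi> p)"
  unfolding smooth_fun_def
proof
  fix x assume x: "x \<in> SU3"
  obtain U F where UF: "open U" "x \<in> U" "C_infinity_on F U" "\<And>y. y \<in> U \<Longrightarrow> y \<in> SU3 \<Longrightarrow> \<phi> (proj y) = F y"
    using smooth_funE[OF assms(1) x] by metis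
  obtain V G where VG: "open V" "x \<in> V" "C_infinity_on G V" "\<And>y. y \<in> V \<Longrightarrow> y \<in> SU3 \<Longrightarrow> \<psi> (proj y) = G y"
    using smooth_funE[OF assms(2) x] by metis
  have "C_infinity_on (\<lambda>y. F y * G y) (U \<inter> V)"
    using UF VG by (intro C_infinity_on_mult) (auto intro: C_infinity_on_subset)
  then show "\<exists>U F. open U \<and> x \<in> U \<and> C_infinity_on F U \<and> (\<forall>y\<in>U \<inter> SU3. \<phi> (proj y) * \<psi> (proj y) = F y)"
    using UF VG by (intro exI[of _ "U \<inter> V"] exI[of _ "\<lambda>y. F y * G y"]) auto
qed

lemma smooth_fun_diff:
  "smooth_fun \<phi> \<Longrightarrow> smooth_fun \<psi> \<Longrightarrow> smooth_fun (\<lambda>p. \<phi> p - \<psi> p)"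
  using smooth_fun_add[OF _ smooth_fun_mult[OF smooth_fun_const[of "-1"]], of \<phi> \<psi>] by simp

lemma smooth_fun_sum:
  "(\<And>i. i \<in> I \<Longrightarrow> smooth_fun (\<phi> i)) \<Longrightarrow> smooth_fun (\<lambda>p. \<Sum>i\<in>I. \<phi> i p)"
  by (induction I rule: infinite_finite_induct) (simp_all add: smooth_fun_add)

lemma smooth_fun_act:
  assumes "k \<in> SU3" "smooth_fun \<phi>" shows "smooth_fun (\<lambda>p. \<phi> (act k p))"
  unfolding smooth_fun_def
proof
  fix x assume x: "x \<in> SU3"
  obtain U F where UF: "open U" "k ** x \<in> U" "C_infinity_on F U" "\<And>y. y \<in> U \<Longrightarrow> y \<in> SU3 \<Longrightarrow> \<phi> (proj y) = F y"
    using smooth_funE[OF assms(2), of "k ** x"] assms(1) x by (metis SU3_mult)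
  have "C_infinity_on (\<lambda>y. F (k ** y)) ((**) k -` U)"
    using UF by (intro C_infinity_on_compose_linear mat3_linear_right)
  moreover have "open ((**) k -` U)"
    by (rule open_vimage[OF UF(1) linear_continuous_on[OF mat3_linear_right]])
  ultimately show "\<exists>U F. open U \<and> x \<in> U \<and> C_infinity_on F U \<and> (\<forall>y\<in>U \<inter> SU3. \<phi> (act k (proj y)) = F y)"
    using UF assms(1) by (intro exI[of _ "(**) k -` U"] exI[of _ "\<lambda>y. F (k ** y)"]) auto
qed

text \<open>Tangent vectors must vanish on functions that are not smooth, so for \<open>push\<close>
  to preserve this, non-smoothness has to be invariant as well.\<close>

lemma smooth_fun_act_iff:
  assumes "k \<in> SU3" shows "smooth_fun (\<lambda>p. \<phi> (act k p)) \<longleftrightarrow> smooth_fun \<phi>"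
proof
  assume "smooth_fun (\<lambda>p. \<phi> (act k p))"
  from smooth_fun_act[OF SU3_adj[OF assms] this] show "smooth_fun \<phi>"
    by (simp add: act_act assms)
qed (rule smooth_fun_act[OF assms])

section \<open>Tangent vectors\<close>

lemma has_real_derivative_proj_curve:
  fixes \<gamma> :: "real \<Rightarrow> mat3"
  assumes "open U" "\<gamma> 0 \<in> U" "F differentiable (at (\<gamma> 0))"
    and "\<And>y. y \<in> U \<Longrightarrow> y \<in> SU3 \<Longrightarrow> \<phi> (proj y) = F y"
    and "\<And>t. \<gamma> t \<in> SU3" "(\<gamma> has_vector_derivative V) (at 0)"
  shows "((\<lambda>t. \<phi> (proj (\<gamma> t))) has_real_derivative frechet_derivative F (at (\<gamma> 0)) V) (at 0)"
proof -
  let ?L = "frechet_derivative F (at (\<gamma> 0))"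
  have L: "(F has_derivative ?L) (at (\<gamma> 0))"
    using assms(3) by (simp add: frechet_derivative_works)
  have "((\<lambda>t. F (\<gamma> t)) has_derivative (\<lambda>h. ?L (h *\<^sub>R V))) (at 0)"
    using has_derivative_compose[of \<gamma> "\<lambda>h. h *\<^sub>R V" 0 UNIV F ?L] assms(6) L
    by (simp add: has_vector_derivative_def)
  moreover have "(\<lambda>h. ?L (h *\<^sub>R V)) = (*) (?L V)"
    using linear_scale[OF has_derivative_linear[OF L]] by (simp add: fun_eq_iff mult.commute)
  ultimately have F: "((\<lambda>t. F (\<gamma> t)) has_real_derivative ?L V) (at 0)"
    by (simp add: has_field_derivative_def)
  \<comment> \<open>By continuity the curve stays in \<open>U\<close> for small times, where
    \<open>F\<close> represents the function.\<close>
  have "isCont \<gamma> 0"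
    using assms(6) has_vector_derivative_continuous by blast
  then have "(\<gamma> \<longlongrightarrow> \<gamma> 0) (nhds 0)"
    by (simp add: isCont_def tendsto_at_iff_tendsto_nhds)
  from topological_tendstoD[OF this assms(1,2)]
  have "\<forall>\<^sub>F t in nhds 0. \<phi> (proj (\<gamma> t)) = F (\<gamma> t)"
    by (rule eventually_mono) (simp add: assms)
  with F show ?thesis by (simp cong: DERIV_cong_ev)
qed

text \<open>The derivative depends on the curve only through its velocity, so the definite
  description in \<open>dproj\<close> has a solution.\<close>

lemma ex_real_derivative_proj:
  assumes "smooth_fun \<phi>" "x \<in> SU3"
  shows "\<exists>L. linear L \<and> (\<forall>\<gamma> V. (\<forall>t. \<gamma> t \<in> SU3) \<longrightarrow> \<gamma> 0 = x \<longrightarrow> (\<gamma> has_vector_derivative V) (at 0) \<longrightarrow>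
    ((\<lambda>t. \<phi> (proj (\<gamma> t))) has_real_derivative L V) (at 0))"
proof -
  obtain U F where UF: "open U" "x \<in> U" "C_infinity_on F U" "\<And>y. y \<in> U \<Longrightarrow> y \<in> SU3 \<Longrightarrow> \<phi> (proj y) = F y"
    using smooth_funE[OF assms] by metis
  have "F differentiable (at x)" using UF C_infinity_on_differentiable by blast
  then show ?thesis
    using UF has_real_derivative_proj_curve[of U _ F \<phi>]
    by (intro exI[of _ "frechet_derivative F (at x)"] conjI linear_frechet_derivative) auto
qed

lemma dproj_nonsmooth: "\<not> smooth_fun \<phi> \<Longrightarrow> dproj A \<phi> = 0"
  by (simp add: dproj_def)

text \<open>The curve in the hypothesis also yields the uniqueness half of the description: without
  a curve of velocity \<open>A\<close> every number would satisfy it vacuously.\<close>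

lemma has_real_derivative_dproj:
  assumes "smooth_fun \<phi>" "su3_curve \<gamma> A"
  shows "((\<lambda>t. \<phi> (proj (\<gamma> t))) has_real_derivative dproj A \<phi>) (at 0)"
proof -
  obtain L where L: "\<And>\<gamma> V. \<lbrakk>\<forall>t. \<gamma> t \<in> SU3; \<gamma> 0 = mat 1; (\<gamma> has_vector_derivative V) (at 0)\<rbrakk> \<Longrightarrow>
    ((\<lambda>t. \<phi> (proj (\<gamma> t))) has_real_derivative L V) (at 0)"
    using ex_real_derivative_proj[OF assms(1) SU3_1] by blast
  have "(THE d. \<forall>\<gamma>::real \<Rightarrow> mat3.
        (\<forall>t. \<gamma> t \<in> SU3) \<and> \<gamma> 0 = mat 1 \<and> (\<gamma> has_vector_derivative A) (at 0) \<longrightarrow>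
        ((\<lambda>t. \<phi> (proj (\<gamma> t))) has_real_derivative d) (at 0)) = L A"
  proof (rule the_equality)
    fix d assume "\<forall>\<gamma>::real \<Rightarrow> mat3.
        (\<forall>t. \<gamma> t \<in> SU3) \<and> \<gamma> 0 = mat 1 \<and> (\<gamma> has_vector_derivative A) (at 0) \<longrightarrow>
        ((\<lambda>t. \<phi> (proj (\<gamma> t))) has_real_derivative d) (at 0)"
    then have "((\<lambda>t. \<phi> (proj (\<gamma> t))) has_real_derivative d) (at 0)"
      using assms(2) by (simp add: su3_curve_def)
    moreover have "((\<lambda>t. \<phi> (proj (\<gamma> t))) has_real_derivative L A) (at 0)"
      using L assms(2) by (simp add: su3_curve_def)
    ultimately show "d = L A" by (rule DERIV_unique)
  qed (use L in blast)
  then have "dproj A \<phi> = L A" using assms(1) by (simp add: dproj_def)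
  then show ?thesis using L assms(2) by (simp add: su3_curve_def)
qed

text \<open>The left frame: the velocity at 0 of \<open>proj (x ** \<gamma> t)\<close> for a curve
  \<open>\<gamma>\<close> through the identity with velocity \<open>A\<close>. Invariant tensors
  have constant coefficients in it.\<close>

definition tvec :: "mat3 \<Rightarrow> mat3 \<Rightarrow> tangent"
  where "tvec x A = push x (dproj A)"

lemma tvec_1: "tvec (mat 1) A = dproj A"
  by (simp add: tvec_def push_def)

lemma push_tvec: "k \<in> SU3 \<Longrightarrow> x \<in> SU3 \<Longrightarrow> push k (tvec x A) = tvec (k ** x) A"
  by (simp add: tvec_def push_def act_act)

lemma tvec_nonsmooth: "x \<in> SU3 \<Longrightarrow> \<not> smooth_fun \<phi> \<Longrightarrow> tvec x A \<phi> = 0"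
  by (simp add: tvec_def push_def dproj_nonsmooth smooth_fun_act_iff)

lemma has_real_derivative_tvec:
  assumes "smooth_fun \<phi>" "x \<in> SU3"
    and "\<And>t. \<gamma> t \<in> SU3" "\<gamma> 0 = x" "(\<gamma> has_vector_derivative x ** A) (at 0)"
  shows "((\<lambda>t. \<phi> (proj (\<gamma> t))) has_real_derivative tvec x A \<phi>) (at 0)"
proof -
  have "((\<lambda>t. adj x ** \<gamma> t) has_vector_derivative adj x ** (x ** A)) (at 0)"
    by (rule bounded_linear.has_vector_derivative[OF mat3_linear_right assms(5)])
  then have "su3_curve (\<lambda>t. adj x ** \<gamma> t) A"
    using assms by (simp add: su3_curve_def)
  from has_real_derivative_dproj[OF smooth_fun_act[OF assms(2,1)] this]
  show ?thesis using assms by (simp add: tvec_def push_def)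
qed

text \<open>Expresses the vector through any local extension of the function to matrices, so that
  linearity in \<open>A\<close> and smoothness in \<open>x\<close> are inherited from the Frechet
  derivative.\<close>

lemma tvec_frechet:
  assumes "x \<in> SU3" "A \<in> su3" "smooth_fun \<phi>"
    and "open U" "x \<in> U" "F differentiable (at x)" "\<And>y. y \<in> U \<Longrightarrow> y \<in> SU3 \<Longrightarrow> \<phi> (proj y) = F y"
  shows "tvec x A \<phi> = frechet_derivative F (at x) (x ** A)"
proof -
  obtain \<gamma> where \<gamma>: "su3_curve \<gamma> A" using su3_curve_exists[OF assms(2)] by blast
  have 1: "((\<lambda>t. x ** \<gamma> t) has_vector_derivative x ** A) (at 0)"
    using \<gamma> by (auto simp: su3_curve_def intro: bounded_linear.has_vector_derivative[OF mat3_linear_right])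
  have 2: "x ** \<gamma> t \<in> SU3" "x ** \<gamma> 0 = x" for t
    using \<gamma> assms by (simp_all add: su3_curve_def)
  show ?thesis
    using DERIV_unique[OF has_real_derivative_tvec[OF assms(3,1) 2 1]
        has_real_derivative_proj_curve[of U "\<lambda>t. x ** \<gamma> t" F \<phi>, OF _ _ _ _ _ 1]] 2 assms by simp
qed

lemma tvec_add:
  assumes "x \<in> SU3" "A \<in> su3" "B \<in> su3"
  shows "tvec x (A + B) = tvec x A + tvec x B"
proof
  fix \<phi>
  show "tvec x (A + B) \<phi> = (tvec x A + tvec x B) \<phi>"
  proof (cases "smooth_fun \<phi>")
    case True
    obtain U F where UF: "open U" "x \<in> U" "C_infinity_on F U" "\<And>y. y \<in> U \<Longrightarrow> y \<in> SU3 \<Longrightarrow> \<phi> (proj y) = F y"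
      using smooth_funE[OF True assms(1)] by metis
    have d: "F differentiable (at x)" using UF C_infinity_on_differentiable by blast
    have "tvec x C \<phi> = frechet_derivative F (at x) (x ** C)" if "C \<in> su3" for C
      by (rule tvec_frechet[OF assms(1) that True UF(1,2) d UF(4)])
    then show ?thesis
      using assms linear_add[OF linear_frechet_derivative[OF d]] by (simp add: matrix_add_ldistrib)
  qed (simp add: tvec_nonsmooth assms)
qed

lemma tvec_scaleR:
  assumes "x \<in> SU3" "A \<in> su3"
  shows "tvec x (c *\<^sub>R A) = c *\<^sub>R tvec x A"
proof
  fix \<phi>
  show "tvec x (c *\<^sub>R A) \<phi> = (c *\<^sub>R tvec x A) \<phi>"
  proof (cases "smooth_fun \<phi>")
    case True
    obtain U F where UF: "open U" "x \<in> U" "C_infinity_on F U" "\<And>y. y \<in> U \<Longrightarrow> y \<in> SU3 \<Longrightarrow> \<phi> (proj y) = F y"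
      using smooth_funE[OF True assms(1)] by metis
    have d: "F differentiable (at x)" using UF C_infinity_on_differentiable by blast
    have "tvec x C \<phi> = frechet_derivative F (at x) (x ** C)" if "C \<in> su3" for C
      by (rule tvec_frechet[OF assms(1) that True UF(1,2) d UF(4)])
    then show ?thesis
      using assms linear_scale[OF linear_frechet_derivative[OF d]] by (simp add: mult_scaleR_right scaleR_fun_def)
  qed (simp add: tvec_nonsmooth assms scaleR_fun_def)
qed

text \<open>The curves \<open>x ** t ** \<gamma> s\<close> and
  \<open>x ** (t ** \<gamma> s ** adj t)\<close> differ by a right factor in \<open>Tmax\<close>,
  hence have the same projection.\<close>

lemma tvec_Tmax:
  assumes "x \<in> SU3" "t \<in> Tmax" "A \<in> su3"
  shows "tvec (x ** t) A = tvec x (conjugate (adj t) A)"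
proof
  fix \<phi>
  have t: "t \<in> SU3" using assms Tmax_SU3 by blast
  show "tvec (x ** t) A \<phi> = tvec x (conjugate (adj t) A) \<phi>"
  proof (cases "smooth_fun \<phi>")
    case True
    obtain \<gamma> where \<gamma>: "su3_curve \<gamma> A" using su3_curve_exists[OF assms(3)] by blast
    have "((\<lambda>s. (x ** t) ** \<gamma> s) has_vector_derivative (x ** t) ** A) (at 0)"
      using \<gamma> by (auto simp: su3_curve_def intro: bounded_linear.has_vector_derivative[OF mat3_linear_right])
    then have 1: "((\<lambda>s. \<phi> (proj ((x ** t) ** \<gamma> s))) has_real_derivative tvec (x ** t) A \<phi>) (at 0)"
      using \<gamma> assms t by (intro has_real_derivative_tvec True) (simp_all add: su3_curve_def)
    have "su3_curve (\<lambda>s. conjugate (adj t) (\<gamma> s)) (conjugate (adj t) A)"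
      using su3_curve_conjugate[OF SU3_adj[OF t] \<gamma>] .
    then have 2: "((\<lambda>s. \<phi> (proj (x ** conjugate (adj t) (\<gamma> s)))) has_real_derivative tvec x (conjugate (adj t) A) \<phi>) (at 0)"
      using assms
      by (intro has_real_derivative_tvec True)
        (auto simp: su3_curve_def intro: bounded_linear.has_vector_derivative[OF mat3_linear_right])
    have "proj (x ** conjugate (adj t) (\<gamma> s)) = proj ((x ** t) ** \<gamma> s)" for s
      using proj_mult_Tmax[of "(x ** t) ** \<gamma> s" "adj t"] \<gamma> assms t
      by (simp add: conjugate_def matrix_mul_assoc su3_curve_def)
    with 1 2 show ?thesis using DERIV_unique by simp
  qed (simp add: tvec_nonsmooth assms t)
qed

text \<open>A diagonal generator has a curve inside \<open>Tmax\<close>, along which the projection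
  does not move.\<close>

lemma tvec_diagonal:
  assumes "x \<in> SU3" "A \<in> su3" "\<And>i j. i \<noteq> j \<Longrightarrow> A $ i $ j = 0"
  shows "tvec x A = 0"
proof
  fix \<phi>
  show "tvec x A \<phi> = 0 \<phi>"
  proof (cases "smooth_fun \<phi>")
    case True
    obtain \<gamma> where \<gamma>: "su3_curve \<gamma> A" "\<And>t. \<gamma> t \<in> Tmax"
      using su3_curve_diagonal_exists[OF assms(2,3)] by blast
    have "((\<lambda>t. \<phi> (proj (x ** \<gamma> t))) has_real_derivative tvec x A \<phi>) (at 0)"
      using assms \<gamma>
      by (intro has_real_derivative_tvec True)
        (auto simp: su3_curve_def intro: bounded_linear.has_vector_derivative[OF mat3_linear_right])
    moreover have "((\<lambda>t. \<phi> (proj (x ** \<gamma> t))) has_real_derivative 0) (at 0)"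
      using \<gamma> assms by (simp add: proj_mult_Tmax)
    ultimately show ?thesis using DERIV_unique by fastforce
  qed (simp add: tvec_nonsmooth assms)
qed

lemma tvec_in_tangent_space:
  assumes "x \<in> SU3" "A \<in> su3"
  shows "tvec x A \<in> tangent_space (proj x)"
proof -
  obtain \<gamma> where \<gamma>: "su3_curve \<gamma> A" using su3_curve_exists[OF assms(2)] by blast
  have "((\<lambda>t. \<phi> (proj (x ** \<gamma> t))) has_real_derivative tvec x A \<phi>) (at 0)" if "smooth_fun \<phi>" for \<phi>
    using assms \<gamma>
    by (intro has_real_derivative_tvec that)
      (auto simp: su3_curve_def intro: bounded_linear.has_vector_derivative[OF mat3_linear_right])
  moreover have "proj (x ** \<gamma> 0) = proj x" using \<gamma> by (simp add: su3_curve_def)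
  ultimately show ?thesis
    using assms by (auto simp: tangent_space_def tvec_nonsmooth intro!: exI[of _ "\<lambda>t. proj (x ** \<gamma> t)"])
qed

section \<open>Coordinate functions\<close>

text \<open>The real part of the trace of K times the projection onto the j-th line. It descends
  because conjugation by the torus fixes diagonal entries. These functions serve as global
  coordinates throughout.\<close>

definition crd :: "3 \<Rightarrow> mat3 \<Rightarrow> flag \<Rightarrow> real"
  where "crd j K = descend (\<lambda>x. Re (conjugate x K $ j $ j))"

lemma conjugate_Tmax_nth: "t \<in> Tmax \<Longrightarrow> conjugate t B $ i $ j = cnj (t $ i $ i) * B $ i $ j * t $ j $ j"
  using exhaust_3[of i] exhaust_3[of j]
  by (auto simp: conjugate_def mult_nth_3 Tmax_def)

lemma conjugate_Tmax_nth_diagonal: "t \<in> Tmax \<Longrightarrow> conjugate t B $ j $ j = B $ j $ j"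
  using Tmax_nth_unit[of t j] by (simp add: conjugate_Tmax_nth mult.commute mult.left_commute)

lemma crd_proj [simp]: "x \<in> SU3 \<Longrightarrow> crd j K (proj x) = Re (conjugate x K $ j $ j)"
  unfolding crd_def
proof (rule descend_proj)
  fix x t :: mat3 assume "t \<in> Tmax"
  then show "Re (conjugate (x ** t) K $ j $ j) = Re (conjugate x K $ j $ j)"
    by (simp only: conjugate_mult conjugate_Tmax_nth_diagonal)
qed

lemma bounded_linear_nth_nth: "bounded_linear (\<lambda>x :: mat3. x $ i $ j)"
  by (rule bounded_linear_compose[OF bounded_linear_vec_nth bounded_linear_vec_nth])

lemma smooth_crd [simp]: "smooth_fun (crd j K)"
proof (rule smooth_funI)
  let ?r = "\<lambda>x :: mat3. \<lambda>k. Re (x $ k $ j)" and ?i = "\<lambda>x :: mat3. \<lambda>k. Im (x $ k $ j)"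
  \<comment> \<open>\<open>C_infinity_on\<close> is about real functions, so the sum of
    \<open>cnj (x $ k $ j) * K $ k $ l * x $ l $ j\<close> is written out in real and imaginary
    parts.\<close>
  let ?F = "\<lambda>x. \<Sum>k\<in>UNIV. \<Sum>l\<in>UNIV. Re (K $ k $ l) * (?r x k * ?r x l + ?i x k * ?i x l)
      + Im (K $ k $ l) * (?i x k * ?r x l + - 1 * (?r x k * ?i x l))"
  have r: "C_infinity_on (\<lambda>x. ?r x k) UNIV" and i: "C_infinity_on (\<lambda>x. ?i x k) UNIV" for k
    by (intro C_infinity_on_bounded_linear bounded_linear_compose[OF bounded_linear_Re bounded_linear_nth_nth]
        bounded_linear_compose[OF bounded_linear_Im bounded_linear_nth_nth])+
  note c = C_infinity_on_const
  note m = C_infinity_on_mult[OF open_UNIV]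
  note a = C_infinity_on_add[OF open_UNIV]
  show "C_infinity_on ?F UNIV"
    by (rule C_infinity_on_sum[OF open_UNIV] C_infinity_on_sum[OF open_UNIV]
        a[OF m[OF c a[OF m[OF r r] m[OF i i]]] m[OF c a[OF m[OF i r] m[OF c m[OF r i]]]]])+
  show "crd j K (proj x) = ?F x" if "x \<in> SU3" for x
    using that by (simp add: conjugate_def mult_nth_3 sum_3 algebra_simps)
qed

lemma crd_single:
  "Re (x $ k $ j * cnj (x $ l $ j)) = Re (conjugate x (axis l (axis k 1)) $ j $ j)"
  "Im (x $ k $ j * cnj (x $ l $ j)) = Re (conjugate x (axis l (axis k (- \<i>))) $ j $ j)"
  using exhaust_3[of k] exhaust_3[of l]
  by (auto simp: conjugate_def mult_nth_3 axis_def)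

text \<open>The (k,l) entry of the orthogonal projection onto the j-th line. A trace against a
  matrix unit picks the transposed position, hence the swapped indices; the factor
  \<open>- \<i>\<close> turns the real part into the imaginary part.\<close>

definition prj :: "3 \<Rightarrow> 3 \<Rightarrow> 3 \<Rightarrow> flag \<Rightarrow> complex"
  where "prj j k l p = Complex (crd j (axis l (axis k 1)) p) (crd j (axis l (axis k (- \<i>))) p)"

lemma prj_proj: "x \<in> SU3 \<Longrightarrow> prj j k l (proj x) = x $ k $ j * cnj (x $ l $ j)"
  by (simp only: prj_def crd_proj crd_single[symmetric] complex_surj)

text \<open>Near the base point, the columns of a representative can be recovered smoothly from the
  projections onto the lines of the flag, by making the diagonal entries positive and correcting
  the determinant in the third column.\<close>

lemma SU3_phase:
  assumes "y \<in> SU3" "y $ 1 $ 1 \<noteq> 0" "y $ 2 $ 2 \<noteq> 0" "y $ 3 $ 3 \<noteq> 0"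
  defines "W \<equiv> \<chi> k j. y $ k $ j * cnj (y $ j $ j) / sqrt (Re (y $ j $ j * cnj (y $ j $ j)))"
  shows "(\<chi> k j. if j = 3 then W $ k $ j * cnj (det W) else W $ k $ j) \<in> (\<lambda>t. y ** t) ` Tmax"
proof -
  define u where "u j = cnj (y $ j $ j) / sqrt (Re (y $ j $ j * cnj (y $ j $ j)))" for j
  have u: "u j * cnj (u j) = 1" for j
  proof -
    have "y $ j $ j \<noteq> 0" using assms(2-4) exhaust_3[of j] by auto
    then have "Re (y $ j $ j * cnj (y $ j $ j)) > 0"
      by (simp add: complex_neq_0 power2_eq_square)
    then have "complex_of_real (sqrt (Re (y $ j $ j * cnj (y $ j $ j)))) * sqrt (Re (y $ j $ j * cnj (y $ j $ j)))
        = y $ j $ j * cnj (y $ j $ j)"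
      by (simp flip: of_real_mult add: complex_eq_iff)
    then show ?thesis using \<open>y $ j $ j \<noteq> 0\<close>
      by (simp add: u_def mult.commute)
  qed
  have "u 1 * cnj (u 1) * (u 2 * cnj (u 2)) * (u 3 * cnj (u 3)) = 1"
    by (simp only: u mult_1)
  then have uuu: "u 1 * (cnj (u 1) * (u 2 * (u 3 * (cnj (u 2) * cnj (u 3))))) = 1"
    by (simp only: ac_simps)
  have W: "W $ k $ j = y $ k $ j * u j" for k j by (simp add: W_def u_def)
  have "det W = det y * (u 1 * u 2 * u 3)"
    by (simp add: det_3 W algebra_simps)
  then have det: "det W = u 1 * u 2 * u 3" using assms(1) by (simp add: SU3_det)
  define t :: mat3 where "t = (\<chi> i j. if i = j then u j * (if j = 3 then cnj (u 1 * u 2 * u 3) else 1) else 0)"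
  have "t \<in> Tmax"
    using u[of 1] u[of 2] u[of 3]
    by (simp add: uuu Tmax_def SU3_iff t_def vec_eq_iff forall_3 mult_nth_3 mat_def det_3 algebra_simps)
  moreover have "(\<chi> k j. if j = 3 then W $ k $ j * cnj (det W) else W $ k $ j) = y ** t"
    by (simp add: vec_eq_iff forall_3 mult_nth_3 W det t_def)
  ultimately show ?thesis by blast
qed

text \<open>The given curve of flags is controlled only through derivatives at 0 of smooth functions
  along it. The entries of its line projections are such functions, and the representative built
  from them is a matrix curve that is differentiable at 0.\<close>

lemma tangent_space_base_imp:
  assumes "v \<in> tangent_space base_point" shows "\<exists>A\<in>su3. v = dproj A"
proof -
  obtain \<gamma> where \<gamma>0: "\<gamma> 0 = base_point"
    and \<gamma>: "\<And>\<phi>. smooth_fun \<phi> \<Longrightarrow> ((\<lambda>t. \<phi> (\<gamma> t)) has_real_derivative v \<phi>) (at 0)"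
    and v0: "\<And>\<phi>. \<not> smooth_fun \<phi> \<Longrightarrow> v \<phi> = 0"
    using assms by (auto simp: tangent_space_def)
  let ?P = "\<lambda>j k l t. prj j k l (\<gamma> t)"
  have P: "(?P j k l) differentiable at 0" for j k l
  proof -
    have "((\<lambda>t. complex_of_real (Re (?P j k l t)) + \<i> * of_real (Im (?P j k l t))) has_vector_derivative
      of_real (v (crd j (axis l (axis k 1)))) + \<i> * of_real (v (crd j (axis l (axis k (- \<i>)))))) (at 0)"
      by (intro has_vector_derivative_add has_vector_derivative_mult_right has_vector_derivative_of_real)
        (simp_all add: prj_def \<gamma>)
    then have "((?P j k l) has_vector_derivative
      of_real (v (crd j (axis l (axis k 1)))) + \<i> * of_real (v (crd j (axis l (axis k (- \<i>)))))) (at 0)"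
      by (simp only: complex_eq[symmetric])
    then show ?thesis by (rule differentiableI_vector)
  qed
  have P0: "?P j k l 0 = (if k = j \<and> l = j then 1 else 0)" for j k l
    by (simp add: \<gamma>0 base_point_def prj_proj) (simp add: mat_def)
  define W where "W t = (\<chi> k j. ?P j k j t / sqrt (Re (?P j j j t)) :: mat3)" for t
  define G where "G t = (\<chi> k j. if j = 3 then W t $ k $ j * cnj (det (W t)) else W t $ k $ j :: mat3)" for t
  \<comment> \<open>At these times the diagonal entries of a representative are nonzero, so its
    phases can be normalised. At 0 they are 1, so nearby times are good.\<close>
  define good where "good t \<longleftrightarrow> Re (?P 1 1 1 t) > 0 \<and> Re (?P 2 2 2 t) > 0 \<and> Re (?P 3 3 3 t) > 0" for t
  have W_diff: "(\<lambda>t. W t $ k $ j) differentiable at 0" for k j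
  proof -
    have 1: "(\<lambda>t. Re (?P j j j t)) differentiable at 0"
      using P[of j j j] by (rule differentiable_compose[OF bounded_linear_imp_differentiable[OF bounded_linear_Re]])
    then obtain d where d: "((\<lambda>t. Re (?P j j j t)) has_real_derivative d) (at 0)"
      using real_differentiableE by blast
    define r where "r t = Re (?P j j j t)" for t
    have "r 0 = 1" by (simp add: r_def P0)
    then have "((\<lambda>t. 1 / sqrt (r t)) has_real_derivative - (d / 2)) (at 0)"
      using d unfolding r_def[symmetric] by (auto intro!: derivative_eq_intros)
    then have "((\<lambda>t. 1 / sqrt (Re (?P j j j t))) has_real_derivative - (d / 2)) (at 0)"
      by (simp add: r_def)
    then have "(\<lambda>t. complex_of_real (1 / sqrt (Re (?P j j j t)))) differentiable at 0"
      using has_vector_derivative_of_real differentiableI_vector by blast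
    then have "(\<lambda>t. ?P j k j t * complex_of_real (1 / sqrt (Re (?P j j j t)))) differentiable at 0"
      by (intro differentiable_mult P)
    then show ?thesis by (simp add: W_def)
  qed
  have det_diff: "(\<lambda>t. cnj (det (W t))) differentiable at 0"
    unfolding det_3
    by (rule differentiable_compose[OF bounded_linear_imp_differentiable[OF bounded_linear_cnj]])
      (intro differentiable_add differentiable_diff differentiable_mult W_diff)
  have "(\<lambda>t. G t $ k $ j) differentiable at 0" for k j
    using differentiable_mult[OF W_diff det_diff, of k j] W_diff[of k j] by (cases "j = 3") (simp_all add: G_def)
  then have "((\<lambda>t. G t $ k $ j) has_vector_derivative vector_derivative (\<lambda>t. G t $ k $ j) (at 0)) (at 0)" for k j
    by (simp add: vector_derivative_works)
  then have "(G has_vector_derivative (\<chi> k j. vector_derivative (\<lambda>t. G t $ k $ j) (at 0))) (at 0)"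
    by (intro has_vector_derivative_vec) simp
  then obtain A where A: "(G has_vector_derivative A) (at 0)" by blast
  have good: "G t \<in> SU3 \<and> proj (G t) = \<gamma> t" if "good t" for t
  proof -
    obtain y where y: "y \<in> SU3" "\<gamma> t = proj y" using proj_cases by blast
    have nz: "y $ j $ j \<noteq> 0" for j
      using that y exhaust_3[of j] by (auto simp: good_def prj_proj)
    have W: "W t = (\<chi> k j. y $ k $ j * cnj (y $ j $ j) / sqrt (Re (y $ j $ j * cnj (y $ j $ j))))"
      unfolding W_def y(2) prj_proj[OF y(1)] ..
    have "G t \<in> (\<lambda>t. y ** t) ` Tmax"
      unfolding G_def W by (rule SU3_phase[OF y(1) nz nz nz])
    then show ?thesis using y by (auto simp: proj_mult_Tmax Tmax_SU3)
  qed
  have ev: "\<forall>\<^sub>F t in nhds 0. good t"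
  proof -
    have "\<forall>\<^sub>F t in nhds 0. Re (?P j j j t) > 0" for j
    proof -
      have "isCont (\<lambda>t. Re (?P j j j t)) 0"
        by (rule continuous_Re[OF differentiable_imp_continuous_within[OF P]])
      then have "((\<lambda>t. Re (?P j j j t)) \<longlongrightarrow> 1) (nhds 0)"
        using tendsto_at_iff_tendsto_nhds[of "\<lambda>t. Re (?P j j j t)" 0] by (simp add: isCont_def P0)
      from order_tendstoD(1)[OF this, of 0] show ?thesis by simp
    qed
    then show ?thesis by (simp add: good_def eventually_conj_iff)
  qed
  \<comment> \<open>\<open>su3_curve\<close> demands membership at all times, so bad times get the
    identity; the germ at 0 is that of \<open>G\<close>.\<close>
  define \<sigma> where "\<sigma> t = (if good t then G t else mat 1)" for t
  have ev': "\<forall>\<^sub>F t in nhds 0. G t = \<sigma> t"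
    using ev by (rule eventually_mono) (simp add: \<sigma>_def)
  have "good 0" using ev eventually_nhds_x_imp_x by blast
  have \<sigma>0: "\<sigma> 0 = mat 1"
  proof -
    have W0: "W 0 = mat 1" by (simp add: W_def P0 vec_eq_iff mat_def)
    have "G 0 = mat 1" unfolding G_def W0 by (simp add: vec_eq_iff)
    then show ?thesis by (simp add: \<sigma>_def)
  qed
  have "(\<sigma> has_vector_derivative A) (at 0)"
    using A has_vector_derivative_cong_ev[of UNIV G \<sigma> 0 A, OF _ eventually_nhds_x_imp_x[OF ev']] ev'
    by simp
  moreover have "\<sigma> t \<in> SU3" for t using good by (simp add: \<sigma>_def)
  ultimately have \<sigma>: "su3_curve \<sigma> A" using \<sigma>0 by (simp add: su3_curve_def)
  then have "A \<in> su3" using SU3_curve_velocity by (auto simp: su3_curve_def)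
  moreover have "v \<phi> = dproj A \<phi>" for \<phi>
  proof (cases "smooth_fun \<phi>")
    case True
    have "\<forall>\<^sub>F t in nhds 0. \<phi> (proj (\<sigma> t)) = \<phi> (\<gamma> t)"
      using ev by (rule eventually_mono) (simp add: \<sigma>_def good)
    with has_real_derivative_dproj[OF True \<sigma>] have "((\<lambda>t. \<phi> (\<gamma> t)) has_real_derivative dproj A \<phi>) (at 0)"
      by (simp cong: DERIV_cong_ev)
    with \<gamma>[OF True] show ?thesis by (rule DERIV_unique)
  qed (simp add: v0 dproj_nonsmooth)
  ultimately show ?thesis by blast
qed

lemma push_tangent:
  assumes "k \<in> SU3" "v \<in> tangent_space p" shows "push k v \<in> tangent_space (act k p)"
proof -
  obtain \<gamma> where "\<gamma> 0 = p" "\<And>\<phi>. smooth_fun \<phi> \<Longrightarrow> ((\<lambda>t. \<phi> (\<gamma> t)) has_real_derivative v \<phi>) (at 0)"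
    "\<And>\<phi>. \<not> smooth_fun \<phi> \<Longrightarrow> v \<phi> = 0"
    using assms(2) by (auto simp: tangent_space_def)
  then show ?thesis
    using smooth_fun_act[OF assms(1)] smooth_fun_act_iff[OF assms(1)]
    by (auto simp: tangent_space_def push_def intro!: exI[of _ "\<lambda>t. act k (\<gamma> t)"])
qed

lemma tangent_space_proj: 
  assumes "x \<in> SU3" shows "tangent_space (proj x) = tvec x ` su3"
proof
  show "tvec x ` su3 \<subseteq> tangent_space (proj x)" using tvec_in_tangent_space assms by auto
  show "tangent_space (proj x) \<subseteq> tvec x ` su3"
  proof
    fix v assume "v \<in> tangent_space (proj x)"
    then have "push (adj x) v \<in> tangent_space base_point"
      using push_tangent[of "adj x"] assms by (fastforce simp: base_point_def)
    then obtain A where "A \<in> su3" "push (adj x) v = dproj A"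
      using tangent_space_base_imp by blast
    then have "push x (push (adj x) v) = tvec x A" by (simp add: tvec_def)
    moreover have "push x (push (adj x) v) = v"
      using assms by (simp add: push_def act_act)
    ultimately show "v \<in> tvec x ` su3" using \<open>A \<in> su3\<close> by auto
  qed
qed

section \<open>Fundamental vector fields\<close>

text \<open>The velocity of the left action by a curve with velocity \<open>A\<close>, written in
  the left frame; the result is independent of the representative by
  \<open>tvec_Tmax\<close>.\<close>

definition fund :: "mat3 \<Rightarrow> vfield"
  where "fund A = descend (\<lambda>x. tvec x (conjugate x A))"

lemma fund_proj:
  assumes "x \<in> SU3" "A \<in> su3" shows "fund A (proj x) = tvec x (conjugate x A)"
  unfolding fund_def
proof (rule descend_proj)
  fix x t assume "x \<in> SU3" "t \<in> Tmax"
  then show "tvec (x ** t) (conjugate (x ** t) A) = tvec x (conjugate x A)"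
    using tvec_Tmax[of x t "conjugate (x ** t) A"] assms(2)
    by (simp add: conjugate_mult Tmax_SU3)
qed (fact assms)

lemma tvec_eq_fund: "x \<in> SU3 \<Longrightarrow> A \<in> su3 \<Longrightarrow> tvec x A = fund (conjugate (adj x) A) (proj x)"
  by (simp add: fund_proj)

lemma fund_add: "A \<in> su3 \<Longrightarrow> B \<in> su3 \<Longrightarrow> fund (A + B) p = fund A p + fund B p"
  by (cases p rule: proj_cases) (simp add: fund_proj conjugate_add tvec_add)

lemma fund_scaleR: "A \<in> su3 \<Longrightarrow> fund (c *\<^sub>R A) p = c *\<^sub>R fund A p"
  by (cases p rule: proj_cases) (simp add: fund_proj conjugate_scaleR tvec_scaleR)

lemma fund_0: "fund 0 p = 0"
  using fund_scaleR[of 0 0 p] by simp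

lemma fund_minus: "A \<in> su3 \<Longrightarrow> fund (- A) p = - fund A p"
  using fund_scaleR[of A "-1" p] by simp

lemma fund_diff: "A \<in> su3 \<Longrightarrow> B \<in> su3 \<Longrightarrow> fund (A - B) p = fund A p - fund B p"
  using fund_add[of A "- B" p] by (simp add: fund_minus)

lemma fund_sum:
  assumes "\<And>i. i \<in> I \<Longrightarrow> A i \<in> su3"
  shows "fund (\<Sum>i\<in>I. A i) p = (\<Sum>i\<in>I. fund (A i) p) \<and> (\<Sum>i\<in>I. A i) \<in> su3"
  using assms by (induction I rule: infinite_finite_induct) (simp_all add: fund_0 fund_add)

lemma tangent_space_eq: "tangent_space p = (\<lambda>A. fund A p) ` su3"
proof (cases p rule: proj_cases)
  case (1 x)
  have "tvec x A \<in> (\<lambda>A. fund A p) ` su3" if "A \<in> su3" for A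
    using that 1 by (simp add: tvec_eq_fund)
  then show ?thesis
    using 1 by (auto simp: tangent_space_proj fund_proj)
qed

lemma tangent_spaceE:
  assumes "v \<in> tangent_space p" obtains A where "A \<in> su3" "v = fund A p"
  using assms by (auto simp: tangent_space_eq)

lemma fund_in_tangent_space [simp]: "A \<in> su3 \<Longrightarrow> fund A p \<in> tangent_space p"
  by (simp add: tangent_space_eq)

lemma tangent_space_add [simp]:
  "v \<in> tangent_space p \<Longrightarrow> w \<in> tangent_space p \<Longrightarrow> v + w \<in> tangent_space p"
  by (auto elim!: tangent_spaceE simp flip: fund_add)

lemma tangent_space_scaleR [simp]: "v \<in> tangent_space p \<Longrightarrow> c *\<^sub>R v \<in> tangent_space p"
  by (auto elim!: tangent_spaceE simp flip: fund_scaleR)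

lemma tangent_space_diff [simp]:
  "v \<in> tangent_space p \<Longrightarrow> w \<in> tangent_space p \<Longrightarrow> v - w \<in> tangent_space p"
  by (auto elim!: tangent_spaceE simp flip: fund_diff)

lemma tangent_space_0 [simp]: "0 \<in> tangent_space p"
  using fund_in_tangent_space[of 0 p] by (simp add: fund_0)

lemma has_real_derivative_fund:
  assumes "smooth_fun \<phi>" "x \<in> SU3" "su3_curve \<gamma> A"
  shows "((\<lambda>t. \<phi> (proj (\<gamma> t ** x))) has_real_derivative fund A (proj x) \<phi>) (at 0)"
proof -
  have A: "A \<in> su3" using assms(3) SU3_curve_velocity by (auto simp: su3_curve_def)
  have "((\<lambda>t. \<gamma> t ** x) has_vector_derivative A ** x) (at 0)"
    using assms(3) by (auto simp: su3_curve_def intro: bounded_linear.has_vector_derivative[OF mat3_linear_left])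
  moreover have "A ** x = x ** conjugate x A"
    using assms(2) by (simp add: conjugate_def matrix_mul_assoc[symmetric])
  ultimately show ?thesis
    using assms has_real_derivative_tvec[OF assms(1,2), of "\<lambda>t. \<gamma> t ** x" "conjugate x A"] A
    by (simp add: fund_proj su3_curve_def)
qed

text \<open>The product rule gives \<open>K ** A + adj A ** K\<close>, and
  \<open>adj A = - A\<close> turns this into a commutator.\<close>

lemma has_vector_derivative_conjugate:
  assumes "su3_curve \<gamma> A"
  shows "((\<lambda>t. conjugate (\<gamma> t ** x) K) has_vector_derivative conjugate x (commutator K A)) (at 0)"
proof -
  have A: "A \<in> su3" using assms SU3_curve_velocity by (auto simp: su3_curve_def)
  have "((\<lambda>t. adj (\<gamma> t) ** (K ** \<gamma> t)) has_vector_derivative adj (\<gamma> 0) ** (K ** A) + adj A ** (K ** \<gamma> 0)) (at 0)"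
    using assms
    by (intro has_vector_derivative_mat3_mult bounded_linear.has_vector_derivative[OF bounded_linear_adj]
        bounded_linear.has_vector_derivative[OF mat3_linear_right])
      (simp_all add: su3_curve_def)
  moreover have "adj (\<gamma> 0) ** (K ** A) + adj A ** (K ** \<gamma> 0) = commutator K A"
    using assms A by (simp add: su3_curve_def su3_def commutator_def mult_minus_left)
  ultimately have "((\<lambda>t. conjugate (\<gamma> t) K) has_vector_derivative commutator K A) (at 0)"
    by (simp add: conjugate_def matrix_mul_assoc)
  then have "((\<lambda>t. conjugate x (conjugate (\<gamma> t) K)) has_vector_derivative conjugate x (commutator K A)) (at 0)"
    by (rule bounded_linear.has_vector_derivative[OF conjugate_linear])
  then show ?thesis by (simp add: conjugate_mult)
qed

text \<open>Both functions that have to be differentiated later are of this form: the metric on two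
  fundamental fields, and a coordinate function differentiated along f of a fundamental
  field.\<close>

lemma fund_bilinear:
  assumes "smooth_fun h" "x \<in> SU3" "A \<in> su3" "bounded_bilinear R"
    and "\<And>y. y \<in> SU3 \<Longrightarrow> h (proj y) = R (conjugate y K) (conjugate y L)"
  shows "fund A (proj x) h = R (conjugate x K) (conjugate x (commutator L A)) + R (conjugate x (commutator K A)) (conjugate x L)"
proof -
  obtain \<gamma> where \<gamma>: "su3_curve \<gamma> A" using su3_curve_exists[OF assms(3)] by blast
  have "((\<lambda>t. R (conjugate (\<gamma> t ** x) K) (conjugate (\<gamma> t ** x) L)) has_vector_derivative
      R (conjugate (\<gamma> 0 ** x) K) (conjugate x (commutator L A)) + R (conjugate x (commutator K A)) (conjugate (\<gamma> 0 ** x) L)) (at 0)"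
    by (intro bounded_bilinear.has_vector_derivative[OF assms(4)] has_vector_derivative_conjugate \<gamma>)
  moreover have "R (conjugate (\<gamma> t ** x) K) (conjugate (\<gamma> t ** x) L) = h (proj (\<gamma> t ** x))" for t
    using \<gamma> assms by (simp add: su3_curve_def)
  ultimately have "((\<lambda>t. h (proj (\<gamma> t ** x))) has_real_derivative
      R (conjugate x K) (conjugate x (commutator L A)) + R (conjugate x (commutator K A)) (conjugate x L)) (at 0)"
    using \<gamma> by (simp add: su3_curve_def has_real_derivative_iff_has_vector_derivative)
  with has_real_derivative_fund[OF assms(1,2) \<gamma>] show ?thesis by (rule DERIV_unique)
qed

text \<open>The coordinate functions are thus stable under fundamental fields, which makes brackets
  a matter of commutators of matrices.\<close>

lemma fund_crd: 
  assumes "A \<in> su3" shows "fund A p (crd j K) = crd j (commutator K A) p"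
proof (cases p rule: proj_cases)
  case (1 x)
  obtain \<gamma> where \<gamma>: "su3_curve \<gamma> A" using su3_curve_exists[OF assms] by blast
  have "((\<lambda>t. Re (conjugate (\<gamma> t ** x) K $ j $ j)) has_vector_derivative Re (conjugate x (commutator K A) $ j $ j)) (at 0)"
    by (intro bounded_linear.has_vector_derivative[OF bounded_linear_compose[OF bounded_linear_Re bounded_linear_nth_nth]]
        has_vector_derivative_conjugate \<gamma>)
  moreover have "Re (conjugate (\<gamma> t ** x) K $ j $ j) = crd j K (proj (\<gamma> t ** x))" for t
    using \<gamma> 1 by (simp add: su3_curve_def)
  ultimately have "((\<lambda>t. crd j K (proj (\<gamma> t ** x))) has_real_derivative Re (conjugate x (commutator K A) $ j $ j)) (at 0)"
    by (simp add: has_real_derivative_iff_has_vector_derivative)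
  from DERIV_unique[OF has_real_derivative_fund[OF smooth_crd 1(1) \<gamma>] this] 1 show ?thesis by simp
qed

lemma fund_in_vector_fields [simp]:
  assumes "A \<in> su3" shows "fund A \<in> vector_fields"
proof -
  have "smooth_fun (\<lambda>p. fund A p \<phi>)" if sm: "smooth_fun \<phi>" for \<phi>
    unfolding smooth_fun_def
  proof
    fix x assume x: "x \<in> SU3"
    obtain U F where UF: "open U" "x \<in> U" "C_infinity_on F U" "\<And>y. y \<in> U \<Longrightarrow> y \<in> SU3 \<Longrightarrow> \<phi> (proj y) = F y"
      using smooth_funE[OF sm x] by metis
    have "fund A (proj y) \<phi> = frechet_derivative F (at y) (A ** y)" if y: "y \<in> U" "y \<in> SU3" for y
    proof -
      have "A ** y = y ** conjugate y A" using y by (simp add: conjugate_def matrix_mul_assoc[symmetric])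
      then show ?thesis
        using tvec_frechet[of y "conjugate y A" \<phi> U F] y assms UF sm C_infinity_on_differentiable[of F U y]
        by (simp add: fund_proj)
    qed
    moreover have "C_infinity_on (\<lambda>y. frechet_derivative F (at y) (A ** y)) U"
      by (rule C_infinity_on_derivative_linear[OF UF(1,3) mat3_linear_right])
    ultimately show "\<exists>U F. open U \<and> x \<in> U \<and> C_infinity_on F U \<and> (\<forall>y\<in>U \<inter> SU3. fund A (proj y) \<phi> = F y)"
      using UF by (intro exI[of _ U] exI[of _ "\<lambda>y. frechet_derivative F (at y) (A ** y)"]) auto
  qed
  then show ?thesis using assms by (simp add: vector_fields_def deriv_along_def)
qed

lemma vector_fields_tangent: "X \<in> vector_fields \<Longrightarrow> X p \<in> tangent_space p"
  by (simp add: vector_fields_def)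

lemma vector_fields_smooth: "X \<in> vector_fields \<Longrightarrow> smooth_fun \<phi> \<Longrightarrow> smooth_fun (\<lambda>p. X p \<phi>)"
  by (simp add: vector_fields_def deriv_along_def)

lemma vector_fields_add [simp]: "X \<in> vector_fields \<Longrightarrow> Y \<in> vector_fields \<Longrightarrow> X + Y \<in> vector_fields"
  by (simp add: vector_fields_def deriv_along_def smooth_fun_add)

lemma vector_fields_scale [simp]:
  "smooth_fun \<phi> \<Longrightarrow> X \<in> vector_fields \<Longrightarrow> fun_scale \<phi> X \<in> vector_fields"
proof -
  assume "smooth_fun \<phi>" "X \<in> vector_fields"
  moreover have "(\<phi> p *\<^sub>R X p) \<psi> = \<phi> p * X p \<psi>" for p \<psi> by (simp add: scaleR_fun_def)
  ultimately show ?thesis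
    by (simp add: vector_fields_def deriv_along_def fun_scale_def smooth_fun_mult)
qed

section \<open>Global frames and tensoriality\<close>

definition single :: "3 \<Rightarrow> 3 \<Rightarrow> complex \<Rightarrow> mat3"
  where "single k l c = axis k (axis l c)"

definition line_proj :: "3 \<Rightarrow> flag \<Rightarrow> mat3"
  where "line_proj j p = (\<chi> k l. prj j k l p)"

text \<open>Applies the vector to each entry of \<open>line_proj\<close>; the indices are swapped as
  in \<open>prj\<close>.\<close>

definition line_proj_deriv :: "3 \<Rightarrow> tangent \<Rightarrow> mat3"
  where "line_proj_deriv j v = (\<chi> k l. Complex (v (crd j (single l k 1))) (v (crd j (single l k (- \<i>)))))"

text \<open>The fundamental field of \<open>A\<close> moves the projections \<open>P\<^sub>j\<close> of a flag by \<open>[A, P\<^sub>j]\<close>, and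
  \<open>1/2 \<Sum>\<^sub>j [[A, P\<^sub>j], P\<^sub>j]\<close> is \<open>A\<close> without its part tangent to the stabiliser. So this recovers
  a generator of a tangent vector, smoothly in the point.\<close>

definition lift :: "flag \<Rightarrow> tangent \<Rightarrow> mat3"
  where "lift p v = (1/2) *\<^sub>R (\<Sum>j\<in>UNIV. commutator (line_proj_deriv j v) (line_proj j p))"

definition off_diag :: "mat3 \<Rightarrow> mat3"
  where "off_diag B = (\<chi> i j. if i = j then 0 else B $ i $ j)"

lemma line_proj_proj: "x \<in> SU3 \<Longrightarrow> line_proj j (proj x) = conjugate (adj x) (single j j 1)"
  using exhaust_3[of j]
  by (auto simp: line_proj_def prj_proj conjugate_def single_def vec_eq_iff forall_3 mult_nth_3 axis_def)

text \<open>Cyclicity of the trace moves the commutator from the first factor to the projection: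
  tr([K, A] P) = tr(K [A, P]), where K is a multiple of a matrix unit.\<close>

lemma conjugate_commutator_single: "x \<in> SU3 \<Longrightarrow> conjugate x (commutator (single l k c) A) $ j $ j = c * commutator A (line_proj j (proj x)) $ k $ l"
  using exhaust_3[of k] exhaust_3[of l]
  by (auto simp: line_proj_def prj_proj conjugate_def commutator_def single_def mult_nth_3 axis_def algebra_simps)

lemma line_proj_deriv_fund:
  assumes "A \<in> su3" shows "line_proj_deriv j (fund A p) = commutator A (line_proj j p)"
proof (cases p rule: proj_cases)
  case (1 x)
  then have "line_proj_deriv j (fund A p) $ k $ l = commutator A (line_proj j p) $ k $ l" for k l
    by (simp add: line_proj_deriv_def fund_crd assms conjugate_commutator_single complex_eq_iff)
  then show ?thesis by (simp add: vec_eq_iff)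
qed

text \<open>For a diagonal matrix unit E the double commutator is B E + E B - 2 E B E. Summing over
  the three units gives twice B minus twice its diagonal, hence the factor 1/2.\<close>

lemma commutator_commutator_off_diag: "(1/2) *\<^sub>R (\<Sum>j\<in>UNIV. commutator (commutator B (single j j 1)) (single j j 1)) = off_diag B"
  by (simp add: sum_3 off_diag_def vec_eq_iff forall_3 commutator_def mult_nth_3 single_def axis_def)

lemma conjugate_lift_fund:
  assumes "x \<in> SU3" "A \<in> su3"
  shows "conjugate x (lift (proj x) (fund A (proj x))) = off_diag (conjugate x A)"
  using assms
  by (simp add: lift_def line_proj_deriv_fund line_proj_proj sum_3 conjugate_scaleR conjugate_add conjugate_commutator flip: commutator_commutator_off_diag)

lemma su3_off_diag [simp]: "A \<in> su3 \<Longrightarrow> off_diag A \<in> su3"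
  by (auto simp: su3_def off_diag_def vec_eq_iff trace_def)

lemma tvec_off_diag:
  assumes "x \<in> SU3" "A \<in> su3" shows "tvec x (off_diag A) = tvec x A"
proof -
  have "tvec x (A - off_diag A) = 0"
    using assms by (intro tvec_diagonal su3_diff su3_off_diag) (auto simp: off_diag_def)
  then show ?thesis using tvec_add[of x "A - off_diag A" "off_diag A"] assms by simp
qed

lemma lift_su3:
  assumes "v \<in> tangent_space p" shows "lift p v \<in> su3" and "fund (lift p v) p = v"
proof -
  obtain x where x: "x \<in> SU3" "p = proj x" using proj_cases by blast
  obtain A where A: "A \<in> su3" "v = fund A p" using assms tangent_spaceE by blast
  have *: "conjugate x (lift p v) = off_diag (conjugate x A)" using conjugate_lift_fund[OF x(1) A(1)] x A by simp
  have "conjugate (adj x) (conjugate x (lift p v)) \<in> su3"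
    unfolding * by (intro su3_conjugate su3_off_diag A SU3_adj x)
  then show s: "lift p v \<in> su3" using x by simp
  show "fund (lift p v) p = v"
    using fund_proj[OF x(1) s] fund_proj[OF x(1) A(1)] tvec_off_diag[OF x(1) su3_conjugate[OF x(1) A(1)]] x(2) A(2) *
    by simp
qed

text \<open>\<open>lift\<close> uses a vector only through its values on coordinate functions and
  yet recovers it, so these functions separate tangent vectors.\<close>

lemma tangent_eqI:
  assumes "v \<in> tangent_space p" "w \<in> tangent_space p" "\<And>j K. v (crd j K) = w (crd j K)"
  shows "v = w"
proof -
  have "lift p v = lift p w" by (simp add: lift_def line_proj_deriv_def assms(3))
  then show ?thesis using lift_su3(2) assms by metis
qed

definition coord :: "bool \<times> 3 \<times> 3 \<Rightarrow> mat3 \<Rightarrow> real"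
  where "coord = (\<lambda>(b, k, l) B. if b then Re (B $ k $ l) else Im (B $ k $ l))"

text \<open>A redundant spanning family with one member for the real and one for the imaginary part
  of each entry. The halves compensate for counting each entry together with its mirror image. The
  multiple of the identity makes diagonal members traceless and cancels in the expansion of a
  traceless matrix.\<close>

definition basis :: "bool \<times> 3 \<times> 3 \<Rightarrow> mat3"
  where "basis = (\<lambda>(b, k, l). if b then single k l (1/2) - single l k (1/2)
    else single k l (\<i>/2) + single l k (\<i>/2) - (if k = l then mat (\<i>/3) else 0))"

lemma basis_su3 [simp]: "basis i \<in> su3"
proof -
  obtain b k l where "i = (b, k, l)" by (cases i)
  then show ?thesis
    using exhaust_3[of k] exhaust_3[of l]
    by (auto simp: basis_def su3_def single_def vec_eq_iff forall_3 trace_def sum_3 axis_def mat_def)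
qed

lemma su3_expand:
  assumes "B \<in> su3" shows "B = (\<Sum>i\<in>UNIV. coord i B *\<^sub>R basis i)"
proof -
  have "(\<Sum>i\<in>UNIV. coord i B *\<^sub>R basis i)
    = (\<Sum>b\<in>UNIV. \<Sum>k\<in>UNIV. \<Sum>l\<in>UNIV. coord (b, k, l) B *\<^sub>R basis (b, k, l))"
    by (simp add: sum.cartesian_product case_prod_beta flip: UNIV_Times_UNIV)
  also have "\<dots> = B"
    using su3_nth[OF assms]
    by (simp add: UNIV_bool sum_3 coord_def basis_def single_def vec_eq_iff forall_3 axis_def mat_def complex_eq_iff field_simps)
  finally show ?thesis by simp
qed

text \<open>The entries of the lift are polynomials in coordinate functions and their derivatives
  along \<open>X\<close>.\<close>

lemma smooth_coord_lift:
  assumes "X \<in> vector_fields" shows "smooth_fun (\<lambda>p. coord i (lift p (X p)))"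
proof -
  define sm where "sm f \<longleftrightarrow> smooth_fun (\<lambda>p. Re (f p)) \<and> smooth_fun (\<lambda>p. Im (f p))" for f
  have mult: "sm (\<lambda>p. f p * g p)" if "sm f" "sm g" for f g
    using that by (simp add: sm_def smooth_fun_mult smooth_fun_add smooth_fun_diff)
  have diff: "sm (\<lambda>p. f p - g p)" if "sm f" "sm g" for f g
    using that by (simp add: sm_def smooth_fun_diff)
  have sum: "sm (\<lambda>p. \<Sum>i\<in>UNIV. f i p)" if "\<And>i. sm (f i)" for f :: "3 \<Rightarrow> flag \<Rightarrow> complex"
    using that by (simp add: sm_def smooth_fun_sum)
  have p: "sm (\<lambda>p. line_proj j p $ k $ l)" for j k l
    by (simp add: sm_def line_proj_def prj_def)
  have v: "sm (\<lambda>p. line_proj_deriv j (X p) $ k $ l)" for j k l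
    by (simp add: sm_def line_proj_deriv_def vector_fields_smooth assms)
  have commutator: "sm (\<lambda>p. commutator (line_proj_deriv j (X p)) (line_proj j p) $ k $ l)" for j k l
    unfolding commutator_def matrix_matrix_mult_def vector_minus_component vec_lambda_beta
    by (rule diff; rule sum; rule mult; rule p v)
  have "sm (\<lambda>p. 1/2 * (\<Sum>j\<in>UNIV. commutator (line_proj_deriv j (X p)) (line_proj j p) $ k $ l))" for k l
    by (rule mult[OF _ sum[OF commutator]]) (simp add: sm_def)
  moreover have "lift p (X p) $ k $ l = 1/2 * (\<Sum>j\<in>UNIV. commutator (line_proj_deriv j (X p)) (line_proj j p) $ k $ l)" for p k l
    by (simp only: lift_def vector_scaleR_component sum_component) (simp add: scaleR_conv_of_real)
  ultimately have "sm (\<lambda>p. lift p (X p) $ k $ l)" for k l by (simp only:)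
  moreover obtain b k l where "i = (b, k, l)" by (cases i)
  ultimately show ?thesis by (cases b) (simp_all add: coord_def sm_def)
qed

lemma sum_fun_apply: "(\<Sum>i\<in>I. F i) p = (\<Sum>i\<in>I. F i p)"
  by (induction I rule: infinite_finite_induct) simp_all

lemma vector_field_expand:
  assumes "X \<in> vector_fields"
  shows "X = (\<Sum>i\<in>UNIV. fun_scale (\<lambda>p. coord i (lift p (X p))) (fund (basis i)))"
proof
  fix p
  have t: "X p \<in> tangent_space p" using assms vector_fields_tangent by blast
  have "X p = fund (\<Sum>i\<in>UNIV. coord i (lift p (X p)) *\<^sub>R basis i) p"
    using su3_expand[OF lift_su3(1)[OF t]] lift_su3(2)[OF t] by simp
  then show "X p = (\<Sum>i\<in>UNIV. fun_scale (\<lambda>p. coord i (lift p (X p))) (fund (basis i))) p"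
    by (simp add: fund_sum fund_scaleR sum_fun_apply fun_scale_def)
qed

lemma tensorial:
  assumes T_add: "\<And>X Y. X \<in> vector_fields \<Longrightarrow> Y \<in> vector_fields \<Longrightarrow> T (X + Y) = T X + T Y"
    and T_scale: "\<And>X \<phi>. X \<in> vector_fields \<Longrightarrow> smooth_fun \<phi> \<Longrightarrow> T (fun_scale \<phi> X) = fun_scale \<phi> (T X)"
    and X: "X \<in> vector_fields" and Y: "Y \<in> vector_fields" and "X p = Y p"
  shows "T X p = T Y p"
proof -
  have 0: "T 0 = 0" and v0: "0 \<in> vector_fields"
    using T_scale[of "fund 0" "\<lambda>p. 0"] vector_fields_scale[of "\<lambda>p. 0" "fund 0"]
    by (simp_all add: fun_scale_def zero_fun_def)
  have T_sum: "T (\<Sum>i\<in>I. F i) = (\<Sum>i\<in>I. T (F i)) \<and> (\<Sum>i\<in>I. F i) \<in> vector_fields"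
    if "\<And>i. i \<in> I \<Longrightarrow> F i \<in> vector_fields" for I and F :: "bool \<times> 3 \<times> 3 \<Rightarrow> vfield"
    using that by (induction I rule: infinite_finite_induct) (simp_all add: 0 v0 T_add)
  \<comment> \<open>On the right-hand side \<open>X\<close> occurs only through its value at
    \<open>p\<close>.\<close>
  have "T X p = (\<Sum>i\<in>UNIV. coord i (lift p (X p)) *\<^sub>R T (fund (basis i)) p)" if "X \<in> vector_fields" for X
  proof -
    have "T X = T (\<Sum>i\<in>UNIV. fun_scale (\<lambda>p. coord i (lift p (X p))) (fund (basis i)))"
      using vector_field_expand[OF that] by simp
    also have "\<dots> = (\<Sum>i\<in>UNIV. fun_scale (\<lambda>p. coord i (lift p (X p))) (T (fund (basis i))))"
      using that by (simp add: T_sum T_scale smooth_coord_lift)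
    finally show ?thesis by (simp add: sum_fun_apply fun_scale_def)
  qed
  with X Y \<open>X p = Y p\<close> show ?thesis by simp
qed

section \<open>Invariant tensors at the base point\<close>

lemma dproj_eq_tvec: "dproj A = tvec (mat 1) A"
  by (simp add: tvec_1)

lemma base_point_fund: "A \<in> su3 \<Longrightarrow> fund A base_point = dproj A"
  by (simp add: base_point_def fund_proj tvec_1)

lemma off_diag_eq_D: "A \<in> su3 \<Longrightarrow> off_diag A = D (A $ 1 $ 2) (A $ 2 $ 3) (- A $ 3 $ 1)"
  using su3_nth[of A] by (simp add: off_diag_def vec_eq_iff forall_3)

lemma off_diag_D [simp]: "off_diag (D a b c) = D a b c"
  by (simp add: off_diag_def vec_eq_iff forall_3)

lemma tvec_eq_D: "x \<in> SU3 \<Longrightarrow> A \<in> su3 \<Longrightarrow> tvec x A = tvec x (D (A $ 1 $ 2) (A $ 2 $ 3) (- A $ 3 $ 1))"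
  using tvec_off_diag[of x A] by (simp add: off_diag_eq_D)

lemma D_inject: "D a b c = D a' b' c' \<longleftrightarrow> a = a' \<and> b = b' \<and> c = c'"
  by (auto simp: vec_eq_iff forall_3)

text \<open>At the identity \<open>lift\<close> reads the off-diagonal part back from the tangent
  vector.\<close>

lemma dproj_off_diag_inject:
  assumes "A \<in> su3" "B \<in> su3" "dproj A = dproj B" shows "off_diag A = off_diag B"
  using conjugate_lift_fund[of "mat 1" A] conjugate_lift_fund[of "mat 1" B] assms
  by (simp add: fund_proj tvec_1)

lemma dproj_D_inject: "dproj (D a b c) = dproj (D a' b' c') \<longleftrightarrow> a = a' \<and> b = b' \<and> c = c'"
  using dproj_off_diag_inject[of "D a b c" "D a' b' c'"] by (auto simp: D_inject)

lemma dproj_add: "A \<in> su3 \<Longrightarrow> B \<in> su3 \<Longrightarrow> dproj (A + B) = dproj A + dproj B"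
  by (simp add: dproj_eq_tvec tvec_add)

lemma dproj_scaleR: "A \<in> su3 \<Longrightarrow> dproj (c *\<^sub>R A) = c *\<^sub>R dproj A"
  by (simp add: dproj_eq_tvec tvec_scaleR)

lemma D_add: "D a b c + D a' b' c' = D (a + a') (b + b') (c + c')"
  by (simp add: vec_eq_iff forall_3)

lemma D_scaleR: "r *\<^sub>R D a b c = D (r *\<^sub>R a) (r *\<^sub>R b) (r *\<^sub>R c)"
  by (simp add: vec_eq_iff forall_3)

lemma D_0: "D 0 0 0 = 0"
  by (simp add: vec_eq_iff forall_3)

lemma dproj_0 [simp]: "dproj 0 = 0"
  using dproj_scaleR[of 0 0] by simp

lemma dproj_tangent [simp]: "A \<in> su3 \<Longrightarrow> dproj A \<in> tangent_space base_point"
  using base_point_fund[of A] fund_in_tangent_space[of A base_point] by simp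

lemma tangent_space_base: "tangent_space base_point = {dproj (D a b c) | a b c. True}"
proof
  show "tangent_space base_point \<subseteq> {dproj (D a b c) | a b c. True}"
  proof
    fix v assume "v \<in> tangent_space base_point"
    then obtain A where A: "A \<in> su3" "v = dproj A"
      using tangent_space_proj[OF SU3_1] by (auto simp: base_point_def tvec_1)
    then show "v \<in> {dproj (D a b c) | a b c. True}"
      using tvec_eq_D[OF SU3_1 A(1)] unfolding tvec_1 by blast
  qed
  show "{dproj (D a b c) | a b c. True} \<subseteq> tangent_space base_point"
    using dproj_tangent[OF su3_D] by blast
qed

lemma act_Tmax_base [simp]: "t \<in> Tmax \<Longrightarrow> act t base_point = base_point"
  using proj_mult_Tmax[of "mat 1" t] by (simp add: base_point_def Tmax_SU3)

text \<open>The isotropy representation: the torus fixes the base point and acts on generators by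
  Ad.\<close>

lemma push_Tmax: "t \<in> Tmax \<Longrightarrow> A \<in> su3 \<Longrightarrow> push t (dproj A) = dproj (conjugate (adj t) A)"
  using tvec_Tmax[of "mat 1" t A] by (simp add: dproj_eq_tvec push_tvec Tmax_SU3)

definition diag :: "complex \<Rightarrow> complex \<Rightarrow> complex \<Rightarrow> mat3"
  where "diag r s t = vector [vector [r, 0, 0], vector [0, s, 0], vector [0, 0, t]]"

lemma diag_Tmax:
  assumes "r * cnj r = 1" "s * cnj s = 1" "t * cnj t = 1" "r * s * t = 1"
  shows "diag r s t \<in> Tmax"
  using assms by (simp add: Tmax_def SU3_iff diag_def vec_eq_iff forall_3 mult_nth_3 mat_def det_3)

lemma conjugate_diag_D: "conjugate (adj (diag r s t)) (D a b c) = D (r * a * cnj s) (s * b * cnj t) (t * c * cnj r)"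
  by (simp add: conjugate_def diag_def vec_eq_iff forall_3 mult_nth_3 mult_ac)

text \<open>The three involutions separate the root spaces; the other two elements force complex
  linearity on each of them.\<close>

definition torus_elements :: "mat3 set"
  where "torus_elements = {diag (- 1) (- 1) 1, diag 1 (- 1) (- 1), diag (- 1) 1 (- 1), diag 1 (- \<i>) \<i>, diag \<i> 1 (- \<i>)}"

lemma torus_elements_Tmax: "t \<in> torus_elements \<Longrightarrow> t \<in> Tmax"
  by (auto simp: torus_elements_def intro!: diag_Tmax)

lemma push_torus:
  "push (diag (- 1) (- 1) 1) (dproj (D a b c)) = dproj (D a (- b) (- c))"
  "push (diag 1 (- 1) (- 1)) (dproj (D a b c)) = dproj (D (- a) b (- c))"
  "push (diag (- 1) 1 (- 1)) (dproj (D a b c)) = dproj (D (- a) (- b) c)"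
  "push (diag 1 (- \<i>) \<i>) (dproj (D a b c)) = dproj (D (\<i> * a) (- b) (\<i> * c))"
  "push (diag \<i> 1 (- \<i>)) (dproj (D a b c)) = dproj (D (\<i> * a) (\<i> * b) (- c))"
  by (simp_all add: push_Tmax torus_elements_Tmax torus_elements_def conjugate_diag_D mult.commute)

section \<open>The shape of an invariant metric\<close>

lemma J_invariant_form:
  fixes \<alpha> :: "complex \<Rightarrow> complex \<Rightarrow> real"
  assumes add: "\<And>x y z. \<alpha> (x + y) z = \<alpha> x z + \<alpha> y z" and scale: "\<And>r x z. \<alpha> (r *\<^sub>R x) z = r * \<alpha> x z"
    and sym: "\<And>x y. \<alpha> x y = \<alpha> y x" and inv: "\<And>x y. \<alpha> (\<i> * x) (\<i> * y) = \<alpha> x y"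
  shows "\<alpha> x y = \<alpha> 1 1 * Re (x * cnj y)"
proof -
  \<comment> \<open>Invariance under multiplication by \<open>\<i>\<close> equates this mixed value
    with its negative; likewise it gives 1 and \<open>\<i>\<close> the same length.\<close>
  have "\<alpha> 1 \<i> = \<alpha> \<i> (- 1 *\<^sub>R 1)" using inv[of 1 \<i>] by simp
  also have "\<dots> = - \<alpha> 1 \<i>" using scale[of "-1" 1 \<i>] sym by simp
  finally have 0: "\<alpha> 1 \<i> = 0" "\<alpha> \<i> 1 = 0" using sym by simp_all
  have 1: "\<alpha> \<i> \<i> = \<alpha> 1 1" using inv[of 1 1] by simp
  have c: "z = Re z *\<^sub>R 1 + Im z *\<^sub>R \<i>" for z by (simp add: complex_eq_iff)
  have left: "\<alpha> z w = Re z * \<alpha> 1 w + Im z * \<alpha> \<i> w" for z w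
    by (subst c[of z]) (simp only: add scale)
  show ?thesis
    using left[of x y] left[of y 1] left[of y \<i>] sym[of 1 y] sym[of \<i> y] 0 1
    by (simp add: algebra_simps)
qed

lemma inner_o_D: "inner_o (D a b c) (D a' b' c') = Re (a * cnj a') + Re (b * cnj b') + Re (c * cnj c')"
  by (simp add: inner_o_def trace_def sum_3 mult_nth_3 algebra_simps)

lemma metric_is_iff:
  "metric_is g (l1, l2, l3) \<longleftrightarrow> (\<forall>a b c a' b' c'. g base_point (dproj (D a b c)) (dproj (D a' b' c')) =
    l1 * Re (a * cnj a') + l2 * Re (b * cnj b') + l3 * Re (c * cnj c'))"
  by (simp add: metric_is_def inner_o_D)

lemma invariant_metric_ex:
  assumes "invariant_metric g"
  shows "\<exists>l1 l2 l3. l1 > 0 \<and> l2 > 0 \<and> l3 > 0 \<and> metric_is g (l1, l2, l3)"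
proof -
  let ?o = base_point and ?T = "tangent_space base_point"
  have sym: "g ?o u v = g ?o v u" if "u \<in> ?T" "v \<in> ?T" for u v
    using assms that unfolding invariant_metric_def riemannian_metric_def by blast
  have add: "g ?o (u + v) w = g ?o u w + g ?o v w" if "u \<in> ?T" "v \<in> ?T" "w \<in> ?T" for u v w
    using assms that unfolding invariant_metric_def riemannian_metric_def by blast
  have scale: "g ?o (r *\<^sub>R u) w = r * g ?o u w" if "u \<in> ?T" "w \<in> ?T" for u w r
    using assms that unfolding invariant_metric_def riemannian_metric_def by blast
  have pos: "g ?o v v > 0" if "v \<in> ?T" "v \<noteq> 0" for v
    using assms that unfolding invariant_metric_def riemannian_metric_def by blast
  define G where "G a b c a' b' c' = g ?o (dproj (D a b c)) (dproj (D a' b' c'))" for a b c a' b' c'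
  have G_sym: "G a b c a' b' c' = G a' b' c' a b c" for a b c a' b' c'
    by (simp add: G_def sym[of "dproj (D a b c)" "dproj (D a' b' c')"])
  have G_add: "G (a + a1) (b + b1) (c + c1) a' b' c' = G a b c a' b' c' + G a1 b1 c1 a' b' c'" for a b c a1 b1 c1 a' b' c'
    by (simp add: G_def add dproj_add flip: D_add)
  have G_scale: "G (r *\<^sub>R a) (r *\<^sub>R b) (r *\<^sub>R c) a' b' c' = r * G a b c a' b' c'" for r a b c a' b' c'
    by (simp add: G_def scale[of "dproj (D a b c)"] dproj_scaleR flip: D_scaleR)
  have inv: "g ?o (push t u) (push t v) = g ?o u v" if "t \<in> torus_elements" "u \<in> ?T" "v \<in> ?T" for t u v
  proof -
    have "g (act t ?o) (push t u) (push t v) = g ?o u v"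
      using assms that torus_elements_Tmax Tmax_SU3 unfolding invariant_metric_def by blast
    then show ?thesis using that torus_elements_Tmax by simp
  qed
  have G_inv: "G a (- b) (- c) a' (- b') (- c') = G a b c a' b' c'"
    "G (- a) b (- c) (- a') b' (- c') = G a b c a' b' c'"
    "G (\<i> * a) (- b) (\<i> * c) (\<i> * a') (- b') (\<i> * c') = G a b c a' b' c'"
    "G (\<i> * a) (\<i> * b) (- c) (\<i> * a') (\<i> * b') (- c') = G a b c a' b' c'" for a b c a' b' c'
    using inv[of "diag (- 1) (- 1) 1" "dproj (D a b c)" "dproj (D a' b' c')"]
      inv[of "diag 1 (- 1) (- 1)" "dproj (D a b c)" "dproj (D a' b' c')"]
      inv[of "diag 1 (- \<i>) \<i>" "dproj (D a b c)" "dproj (D a' b' c')"]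
      inv[of "diag \<i> 1 (- \<i>)" "dproj (D a b c)" "dproj (D a' b' c')"]
    by (simp_all add: G_def torus_elements_def push_torus)
  have split: "G a b c a' b' c' = G a 0 0 a' b' c' + G 0 b 0 a' b' c' + G 0 0 c a' b' c'" for a b c a' b' c'
    using G_add[of a 0 b 0 0 c a' b' c'] G_add[of a 0 0 b 0 0 a' b' c'] by simp
  \<comment> \<open>Some involution of the torus fixes one of the two root spaces and negates the
    other, so the mixed value equals its negative.\<close>
  have cross: "G a 0 0 0 b 0 = 0" "G a 0 0 0 0 c = 0" "G 0 b 0 0 0 c = 0" for a b c
    using G_inv(1)[of a 0 0 0 b 0] G_scale[of "-1" 0 b 0 a 0 0] G_sym[of a 0 0 0 b 0] G_sym[of a 0 0 0 "-b" 0]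
      G_inv(1)[of a 0 0 0 0 c] G_scale[of "-1" 0 0 c a 0 0] G_sym[of a 0 0 0 0 c] G_sym[of a 0 0 0 0 "-c"]
      G_inv(2)[of 0 b 0 0 0 c] G_scale[of "-1" 0 0 c 0 b 0] G_sym[of 0 b 0 0 0 c] G_sym[of 0 b 0 0 0 "-c"]
    by simp_all
  have G_eq: "G a b c a' b' c' = G a 0 0 a' 0 0 + G 0 b 0 0 b' 0 + G 0 0 c 0 0 c'" for a b c a' b' c'
    using split[of a b c a' b' c'] split[of a' b' c' a 0 0] split[of a' b' c' 0 b 0] split[of a' b' c' 0 0 c]
      G_sym[of a 0 0 a' b' c'] G_sym[of 0 b 0 a' b' c'] G_sym[of 0 0 c a' b' c']
      cross(1)[of a b'] cross(2)[of a c'] cross(1)[of a' b] cross(3)[of b c'] cross(2)[of a' c] cross(3)[of b' c]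
      G_sym[of 0 b' 0 a 0 0] G_sym[of 0 0 c' a 0 0] G_sym[of 0 0 c' 0 b 0]
      G_sym[of a' 0 0 a 0 0] G_sym[of 0 b' 0 0 b 0] G_sym[of 0 0 c' 0 0 c]
    by linarith
  define l1 l2 l3 where "l1 = G 1 0 0 1 0 0" and "l2 = G 0 1 0 0 1 0" and "l3 = G 0 0 1 0 0 1"
  have "G a 0 0 a' 0 0 = l1 * Re (a * cnj a')" for a a'
    unfolding l1_def
  proof (rule J_invariant_form)
    show "G (x + y) 0 0 z 0 0 = G x 0 0 z 0 0 + G y 0 0 z 0 0" for x y z
      using G_add[of x y 0 0 0 0 z 0 0] by simp
    show "G (r *\<^sub>R x) 0 0 z 0 0 = r * G x 0 0 z 0 0" for r x z
      using G_scale[of r x 0 0 z 0 0] by simp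
    show "G x 0 0 y 0 0 = G y 0 0 x 0 0" for x y
      by (rule G_sym)
    show "G (\<i> * x) 0 0 (\<i> * y) 0 0 = G x 0 0 y 0 0" for x y
      using G_inv(4)[of x 0 0 y 0 0] by simp
  qed
  moreover have "G 0 b 0 0 b' 0 = l2 * Re (b * cnj b')" for b b'
    unfolding l2_def
  proof (rule J_invariant_form)
    show "G 0 (x + y) 0 0 z 0 = G 0 x 0 0 z 0 + G 0 y 0 0 z 0" for x y z
      using G_add[of 0 0 x y 0 0 0 z 0] by simp
    show "G 0 (r *\<^sub>R x) 0 0 z 0 = r * G 0 x 0 0 z 0" for r x z
      using G_scale[of r 0 x 0 0 z 0] by simp
    show "G 0 x 0 0 y 0 = G 0 y 0 0 x 0" for x y
      by (rule G_sym)
    show "G 0 (\<i> * x) 0 0 (\<i> * y) 0 = G 0 x 0 0 y 0" for x y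
      using G_inv(4)[of 0 x 0 0 y 0] by simp
  qed
  moreover have "G 0 0 c 0 0 c' = l3 * Re (c * cnj c')" for c c'
    unfolding l3_def
  proof (rule J_invariant_form)
    show "G 0 0 (x + y) 0 0 z = G 0 0 x 0 0 z + G 0 0 y 0 0 z" for x y z
      using G_add[of 0 0 0 0 x y 0 0 z] by simp
    show "G 0 0 (r *\<^sub>R x) 0 0 z = r * G 0 0 x 0 0 z" for r x z
      using G_scale[of r 0 0 x 0 0 z] by simp
    show "G 0 0 x 0 0 y = G 0 0 y 0 0 x" for x y
      by (rule G_sym)
    show "G 0 0 (\<i> * x) 0 0 (\<i> * y) = G 0 0 x 0 0 y" for x y
      using G_inv(3)[of 0 0 x 0 0 y] by simp
  qed
  ultimately have "metric_is g (l1, l2, l3)"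
    unfolding metric_is_iff G_def[symmetric] by (subst G_eq) (simp only:, blast)
  moreover have "G a b c a b c > 0" if "a \<noteq> 0 \<or> b \<noteq> 0 \<or> c \<noteq> 0" for a b c
  proof -
    have "dproj (D a b c) \<noteq> 0"
      using that dproj_D_inject[of a b c 0 0 0] by (simp add: D_0)
    then show ?thesis unfolding G_def by (intro pos) simp_all
  qed
  then have "l1 > 0" "l2 > 0" "l3 > 0" by (simp_all add: l1_def l2_def l3_def)
  ultimately show ?thesis by blast
qed

lemma metric_is_unique:
  assumes "metric_is g (l1, l2, l3)" "metric_is g (m1, m2, m3)"
  shows "l1 = m1 \<and> l2 = m2 \<and> l3 = m3"
proof -
  have "l1 * Re (a * cnj a) + l2 * Re (b * cnj b) + l3 * Re (c * cnj c)
    = m1 * Re (a * cnj a) + m2 * Re (b * cnj b) + m3 * Re (c * cnj c)" for a b c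
    using assms unfolding metric_is_iff by metis
  from this[of 1 0 0] this[of 0 1 0] this[of 0 0 1] show ?thesis by simp
qed

lemma f_structure_is_unique:
  assumes "f_structure_is f (z1, z2, z3)" "f_structure_is f (w1, w2, w3)"
  shows "z1 = w1 \<and> z2 = w2 \<and> z3 = w3"
proof -
  have "dproj (D (of_real z1 * \<i> * 1) (of_real z2 * \<i> * 1) (of_real z3 * \<i> * 1))
      = dproj (D (of_real w1 * \<i> * 1) (of_real w2 * \<i> * 1) (of_real w3 * \<i> * 1))"
    using assms unfolding f_structure_is_def prod.case by metis
  then show ?thesis by (simp add: dproj_D_inject)
qed

section \<open>The shape of an invariant f-structure\<close>

lemma cube_plus_self_zero:
  fixes z :: complex
  assumes "z * (z * z) + z = 0" shows "\<exists>r\<in>{-1, 0, 1}. z = of_real r * \<i>"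
proof -
  \<comment> \<open>The three roots are where the values 0, 1, -1 of the parameters come
    from.\<close>
  have "z * ((z - \<i>) * (z + \<i>)) = 0" using assms by (simp add: algebra_simps)
  then have "z = 0 \<or> z = \<i> \<or> z = - \<i>" by (auto simp: add_eq_0_iff2)
  then show ?thesis by auto
qed

lemma complex_linearI:
  fixes u :: "complex \<Rightarrow> complex"
  assumes "\<And>x y. u (x + y) = u x + u y" "\<And>r x. u (r *\<^sub>R x) = r *\<^sub>R u x" "\<And>x. u (\<i> * x) = \<i> * u x"
  shows "u x = u 1 * x"
proof -
  have c: "x = Re x *\<^sub>R 1 + Im x *\<^sub>R (\<i> * 1)" by (simp add: complex_eq_iff)
  have "u x = Re x *\<^sub>R u 1 + Im x *\<^sub>R (\<i> * u 1)"
    by (subst c) (simp only: assms)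
  also have "\<dots> = u 1 * x" by (simp add: complex_eq_iff)
  finally show ?thesis .
qed

lemma invariant_f_structure_ex:
  assumes "invariant_f_structure f"
  shows "\<exists>z1\<in>{-1, 0, 1}. \<exists>z2\<in>{-1, 0, 1}. \<exists>z3\<in>{-1, 0, 1}. f_structure_is f (z1, z2, z3)"
proof -
  let ?o = base_point and ?T = "tangent_space base_point"
  have tan: "f ?o u \<in> ?T" if "u \<in> ?T" for u
    using assms that unfolding invariant_f_structure_def f_structure_def by blast
  have add: "f ?o (u + w) = f ?o u + f ?o w" if "u \<in> ?T" "w \<in> ?T" for u w
    using assms that unfolding invariant_f_structure_def f_structure_def by blast
  have scale: "f ?o (r *\<^sub>R u) = r *\<^sub>R f ?o u" if "u \<in> ?T" for u r
    using assms that unfolding invariant_f_structure_def f_structure_def by blast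
  have cube: "f ?o (f ?o (f ?o u)) + f ?o u = 0" if "u \<in> ?T" for u
    using assms that unfolding invariant_f_structure_def f_structure_def by blast
  have "\<forall>a b c. \<exists>a' b' c'. f ?o (dproj (D a b c)) = dproj (D a' b' c')"
    using tan tangent_space_base by fastforce
  then obtain P Q R where PQR: "f ?o (dproj (D a b c)) = dproj (D (P a b c) (Q a b c) (R a b c))" for a b c
    by metis
  have inv: "f ?o (push t u) = push t (f ?o u)" if "t \<in> torus_elements" "u \<in> ?T" for t u
  proof -
    have "f (act t ?o) (push t u) = push t (f ?o u)"
      using assms that torus_elements_Tmax Tmax_SU3 unfolding invariant_f_structure_def by blast
    then show ?thesis using that torus_elements_Tmax by simp
  qed
  \<comment> \<open>Commuting with the involutions makes \<open>f\<close> preserve each root space;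
    commuting with the elements of order four makes it complex linear there.\<close>
  have eqs: "P a (- b) (- c) = P a b c" "Q a (- b) (- c) = - Q a b c" "R a (- b) (- c) = - R a b c"
    "P (- a) b (- c) = - P a b c" "Q (- a) b (- c) = Q a b c" "R (- a) b (- c) = - R a b c"
    "P (- a) (- b) c = - P a b c" "Q (- a) (- b) c = - Q a b c" "R (- a) (- b) c = R a b c"
    "R (\<i> * a) (- b) (\<i> * c) = \<i> * R a b c"
    "P (\<i> * a) (\<i> * b) (- c) = \<i> * P a b c" "Q (\<i> * a) (\<i> * b) (- c) = \<i> * Q a b c" for a b c
    using inv[of "diag (- 1) (- 1) 1" "dproj (D a b c)"] inv[of "diag 1 (- 1) (- 1)" "dproj (D a b c)"]
      inv[of "diag (- 1) 1 (- 1)" "dproj (D a b c)"]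
      inv[of "diag 1 (- \<i>) \<i>" "dproj (D a b c)"] inv[of "diag \<i> 1 (- \<i>)" "dproj (D a b c)"]
    by (simp_all add: torus_elements_def push_torus PQR dproj_D_inject)
  have PQR_add: "P (a + a') (b + b') (c + c') = P a b c + P a' b' c' \<and> Q (a + a') (b + b') (c + c') = Q a b c + Q a' b' c'
      \<and> R (a + a') (b + b') (c + c') = R a b c + R a' b' c'" for a b c a' b' c'
    using add[of "dproj (D a b c)" "dproj (D a' b' c')"]
    by (simp add: PQR D_add dproj_D_inject flip: dproj_add)
  have PQR_scale: "P (r *\<^sub>R a) (r *\<^sub>R b) (r *\<^sub>R c) = r *\<^sub>R P a b c \<and> Q (r *\<^sub>R a) (r *\<^sub>R b) (r *\<^sub>R c) = r *\<^sub>R Q a b c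
      \<and> R (r *\<^sub>R a) (r *\<^sub>R b) (r *\<^sub>R c) = r *\<^sub>R R a b c" for r a b c
    using scale[of "dproj (D a b c)" r] 
    by (simp add: PQR D_scaleR dproj_D_inject flip: dproj_scaleR)
  have zero: "Q a 0 0 = 0" "R a 0 0 = 0" "P 0 b 0 = 0" "R 0 b 0 = 0" "P 0 0 c = 0" "Q 0 0 c = 0" for a b c
    using eqs(2,3)[of a 0 0] eqs(4,6)[of 0 b 0] eqs(7,8)[of 0 0 c] by simp_all
  define p q r where "p = P 1 0 0" and "q = Q 0 1 0" and "r = R 0 0 1"
  have P: "P a 0 0 = p * a" for a
    unfolding p_def
    by (rule complex_linearI)
      (use PQR_add[of _ _ 0 0 0 0] PQR_scale[of _ _ 0 0] eqs(11)[of _ 0 0] in simp_all)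
  have Q: "Q 0 b 0 = q * b" for b
    unfolding q_def
    by (rule complex_linearI)
      (use PQR_add[of 0 0 _ _ 0 0] PQR_scale[of _ 0 _ 0] eqs(12)[of 0 _ 0] in simp_all)
  have R: "R 0 0 c = r * c" for c
    unfolding r_def
    by (rule complex_linearI)
      (use PQR_add[of 0 0 0 0] PQR_scale[of _ 0 0] eqs(10)[of 0 0] in simp_all)
  have all: "P a b c = p * a" "Q a b c = q * b" "R a b c = r * c" for a b c
    using PQR_add[of a 0 b 0 0 c] PQR_add[of a 0 0 b 0 0] zero P Q R by simp_all
  have f: "f ?o (dproj (D a b c)) = dproj (D (p * a) (q * b) (r * c))" for a b c
    by (simp only: PQR all)
  \<comment> \<open>One vector with all parameters 1 tests the cubic equation on the three root
    spaces at once.\<close>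
  have "dproj (D (p * (p * p) + p) (q * (q * q) + q) (r * (r * r) + r)) = dproj (D 0 0 0)"
    using cube[of "dproj (D 1 1 1)"] by (simp add: f D_0 D_add flip: dproj_add)
  then have "p * (p * p) + p = 0" "q * (q * q) + q = 0" "r * (r * r) + r = 0"
    by (simp_all add: dproj_D_inject)
  then obtain z1 z2 z3 where "z1 \<in> {-1, 0, 1}" "z2 \<in> {-1, 0, 1}" "z3 \<in> {-1, 0, 1}"
    and "p = of_real z1 * \<i>" "q = of_real z2 * \<i>" "r = of_real z3 * \<i>"
    using cube_plus_self_zero by metis
  moreover from this have "f_structure_is f (z1, z2, z3)"
    by (simp add: f_structure_is_def f)
  ultimately show ?thesis by blast
qed

section \<open>The Killing and Kaehler conditions\<close>

text \<open>The endomorphism of generators that represents f in the left frame. Diagonal parts,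
  which represent zero, are dropped; the minus sign converts the (3,1) entry into the third
  parameter of \<open>D\<close>.\<close>

definition fmap :: "real \<times> real \<times> real \<Rightarrow> mat3 \<Rightarrow> mat3"
  where "fmap = (\<lambda>(z1, z2, z3) B. D (z1 * \<i> * B $ 1 $ 2) (z2 * \<i> * B $ 2 $ 3) (z3 * \<i> * (- B $ 3 $ 1)))"

text \<open>The metric in the left frame, with diagonal matrices in its kernel. Here the sign of the
  third parameter cancels in the product.\<close>

definition qform :: "real \<times> real \<times> real \<Rightarrow> mat3 \<Rightarrow> mat3 \<Rightarrow> real"
  where "qform = (\<lambda>(l1, l2, l3) A B. l1 * Re (A $ 1 $ 2 * cnj (B $ 1 $ 2)) + l2 * Re (A $ 2 $ 3 * cnj (B $ 2 $ 3))
    + l3 * Re (A $ 3 $ 1 * cnj (B $ 3 $ 1)))"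

lemma fmap_su3 [simp]: "fmap z B \<in> su3"
  by (simp add: fmap_def case_prod_beta)

lemma bounded_linear_fmap: "bounded_linear (fmap z)"
  by (cases z, intro linear_conv_bounded_linear[THEN iffD1] linearI)
    (simp_all add: fmap_def D_add D_scaleR D_inject algebra_simps)

lemmas fmap_add = linear_add[OF bounded_linear.linear[OF bounded_linear_fmap]]
lemmas fmap_scaleR = linear_scale[OF bounded_linear.linear[OF bounded_linear_fmap]]

lemma bounded_bilinear_qform: "bounded_bilinear (qform l)"
  unfolding bilinear_conv_bounded_bilinear[symmetric] bilinear_def
  by (cases l) (auto intro!: linearI simp: qform_def algebra_simps)

lemmas qform_minus_left = bounded_bilinear.minus_left[OF bounded_bilinear_qform]

lemma qform_sym: "qform l A B = qform l B A"
  by (cases l) (simp add: qform_def mult.commute)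

text \<open>Multiplication by a real multiple of \<open>\<i>\<close> is skew for
  \<open>Re (x * cnj y)\<close> on each root space.\<close>

lemma qform_fmap: "qform l (fmap z A) B = - qform l A (fmap z B)"
  by (cases l, cases z) (simp add: qform_def fmap_def algebra_simps)

text \<open>The Koszul formula for fundamental fields: twice the scalar product of
  \<open>\<nabla>\<^bsub>B\<^sup>*\<^esub> A\<^sup>*\<close> with \<open>C\<^sup>*\<close> at the base point.\<close>

definition koszul :: "real \<times> real \<times> real \<Rightarrow> mat3 \<Rightarrow> mat3 \<Rightarrow> mat3 \<Rightarrow> real"
  where "koszul l B A C = qform l (commutator A B) C + qform l (commutator C B) A + qform l (commutator C A) B"

text \<open>For A in the first root space, B and C contribute from the other two. In
  \<open>koszul\<close> the slots of B and C then count with their own metric coefficients and that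
  of A with the opposite sign, hence \<open>l2 + l3 - l1\<close>. Applying f to B in one summand and
  to C in the other multiplies the same complex product by \<open>\<i> * z2\<close> or
  \<open>\<i> * z3\<close>, hence \<open>z2 + z3\<close>.\<close>

lemma koszul_fmap:
  assumes "A \<in> su3" "B \<in> su3" "C \<in> su3"
  shows "koszul (l1, l2, l3) (fmap (z1, z2, z3) B) A C + koszul (l1, l2, l3) B A (fmap (z1, z2, z3) C) =
    (l2 + l3 - l1) * (z2 + z3) * Re (\<i> * A $ 1 $ 2 * (B $ 3 $ 1 * C $ 2 $ 3 - B $ 2 $ 3 * C $ 3 $ 1)) +
    (l1 + l3 - l2) * (z1 + z3) * Re (\<i> * A $ 2 $ 3 * (B $ 1 $ 2 * C $ 3 $ 1 - B $ 3 $ 1 * C $ 1 $ 2)) +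
    (l1 + l2 - l3) * (z1 + z2) * Re (\<i> * A $ 3 $ 1 * (B $ 2 $ 3 * C $ 1 $ 2 - B $ 1 $ 2 * C $ 2 $ 3))"
  using su3_nth[OF assms(1)] su3_nth[OF assms(2)] su3_nth[OF assms(3)]
  by (simp add: koszul_def qform_def fmap_def commutator_def mult_nth_3 algebra_simps)

section \<open>The covariant derivative of an invariant f-structure on fundamental fields\<close>

locale flag_structures =
  fixes g :: metric and nabla :: connection and f :: tensor11
    and l1 l2 l3 z1 z2 z3 :: real
  assumes inv_g: "invariant_metric g" and lc: "levi_civita g nabla" and inv_f: "invariant_f_structure f"
    and g_eq: "metric_is g (l1, l2, l3)" and f_eq: "f_structure_is f (z1, z2, z3)"
begin

abbreviation "q \<equiv> qform (l1, l2, l3)"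
abbreviation "F \<equiv> fmap (z1, z2, z3)"

lemma g_add: "u \<in> tangent_space p \<Longrightarrow> v \<in> tangent_space p \<Longrightarrow> w \<in> tangent_space p \<Longrightarrow> g p (u + v) w = g p u w + g p v w"
  using inv_g unfolding invariant_metric_def riemannian_metric_def by blast

lemma g_scale: "u \<in> tangent_space p \<Longrightarrow> w \<in> tangent_space p \<Longrightarrow> g p (c *\<^sub>R u) w = c * g p u w"
  using inv_g unfolding invariant_metric_def riemannian_metric_def by blast

lemma g_sym: "u \<in> tangent_space p \<Longrightarrow> v \<in> tangent_space p \<Longrightarrow> g p u v = g p v u"
  using inv_g unfolding invariant_metric_def riemannian_metric_def by blast

lemma g_pos: "v \<in> tangent_space p \<Longrightarrow> v \<noteq> 0 \<Longrightarrow> g p v v > 0"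
  using inv_g unfolding invariant_metric_def riemannian_metric_def by blast

lemma g_smooth: "X \<in> vector_fields \<Longrightarrow> Y \<in> vector_fields \<Longrightarrow> smooth_fun (\<lambda>p. g p (X p) (Y p))"
  using inv_g unfolding invariant_metric_def riemannian_metric_def by blast

lemma g_diff: "u \<in> tangent_space p \<Longrightarrow> v \<in> tangent_space p \<Longrightarrow> w \<in> tangent_space p \<Longrightarrow> g p (u - v) w = g p u w - g p v w"
  using g_add[of u p "-1 *\<^sub>R v" w] g_scale[of v p w "-1"] tangent_space_scaleR[of v p "-1"] by simp

text \<open>Invariance moves the computation to the base point, where replacing a generator by its
  off-diagonal part does not change the tangent vector.\<close>

lemma g_tvec:
  assumes "x \<in> SU3" "A \<in> su3" "B \<in> su3"
  shows "g (proj x) (tvec x A) (tvec x B) = q A B"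
proof -
  have 1: "tvec x C = push x (dproj C)" for C by (simp add: tvec_def)
  have 2: "dproj C = dproj (D (C $ 1 $ 2) (C $ 2 $ 3) (- C $ 3 $ 1))" if "C \<in> su3" for C
    using tvec_eq_D[OF SU3_1 that] by (simp only: tvec_1)
  have "g (act x base_point) (push x (dproj A)) (push x (dproj B)) = g base_point (dproj A) (dproj B)"
    using inv_g assms unfolding invariant_metric_def by (meson dproj_tangent)
  then have "g (proj x) (tvec x A) (tvec x B) = g base_point (dproj A) (dproj B)"
    using assms by (simp add: 1 base_point_def)
  also have "\<dots> = q A B"
    unfolding 2[OF assms(2)] 2[OF assms(3)]
    using g_eq unfolding metric_is_iff by (simp add: qform_def)
  finally show ?thesis .
qed

lemma g_fund: "x \<in> SU3 \<Longrightarrow> A \<in> su3 \<Longrightarrow> B \<in> su3 \<Longrightarrow> g (proj x) (fund A (proj x)) (fund B (proj x)) = q (conjugate x A) (conjugate x B)"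
  by (simp add: fund_proj g_tvec)

lemma f_tangent [simp]: "v \<in> tangent_space p \<Longrightarrow> f p v \<in> tangent_space p"
  using inv_f unfolding invariant_f_structure_def f_structure_def by blast

lemma f_add: "u \<in> tangent_space p \<Longrightarrow> v \<in> tangent_space p \<Longrightarrow> f p (u + v) = f p u + f p v"
  using inv_f unfolding invariant_f_structure_def f_structure_def by blast

lemma f_scale: "u \<in> tangent_space p \<Longrightarrow> f p (c *\<^sub>R u) = c *\<^sub>R f p u"
  using inv_f unfolding invariant_f_structure_def f_structure_def by blast

lemma f_fields [simp]: "X \<in> vector_fields \<Longrightarrow> tensor_apply f X \<in> vector_fields"
  using inv_f unfolding invariant_f_structure_def f_structure_def by blast

lemma f_tvec:
  assumes "x \<in> SU3" "A \<in> su3" shows "f (proj x) (tvec x A) = tvec x (F A)"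
proof -
  have 1: "dproj A = dproj (D (A $ 1 $ 2) (A $ 2 $ 3) (- A $ 3 $ 1))"
    using tvec_eq_D[OF SU3_1 assms(2)] by (simp only: tvec_1)
  have "f (act x base_point) (push x (dproj A)) = push x (f base_point (dproj A))"
    using inv_f assms unfolding invariant_f_structure_def by (meson dproj_tangent)
  also have "f base_point (dproj A) = dproj (F A)"
    using f_eq unfolding f_structure_is_def 1 by (simp add: fmap_def)
  finally show ?thesis using assms by (simp add: tvec_def base_point_def)
qed

lemma f_fund: "x \<in> SU3 \<Longrightarrow> A \<in> su3 \<Longrightarrow> f (proj x) (fund A (proj x)) = fund (conjugate (adj x) (F (conjugate x A))) (proj x)"
  by (simp add: fund_proj f_tvec)

lemma metric_f: "metric_f_structure g f"
proof -
  have "g p (f p v) w + g p v (f p w) = 0" if vw: "v \<in> tangent_space p" "w \<in> tangent_space p" for p v w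
  proof -
    obtain x where x: "x \<in> SU3" "p = proj x" using proj_cases by blast
    obtain A B where "A \<in> su3" "B \<in> su3" "v = tvec x A" "w = tvec x B"
      using vw x tangent_space_proj by auto
    then show ?thesis using x by (simp add: f_tvec g_tvec qform_fmap)
  qed
  then show ?thesis using inv_f by (simp add: metric_f_structure_def invariant_f_structure_def)
qed

lemma nabla_fields [simp]: "X \<in> vector_fields \<Longrightarrow> Y \<in> vector_fields \<Longrightarrow> nabla X Y \<in> vector_fields"
  using lc unfolding levi_civita_def affine_connection_def by blast

lemma nabla_add:
  assumes "X \<in> vector_fields" "Y \<in> vector_fields" "Z \<in> vector_fields"
  shows "nabla (X + Y) Z = nabla X Z + nabla Y Z" "nabla X (Y + Z) = nabla X Y + nabla X Z"
  using lc assms unfolding levi_civita_def affine_connection_def by blast+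

lemma nabla_scale:
  assumes "X \<in> vector_fields" "Y \<in> vector_fields" "smooth_fun \<phi>"
  shows "nabla (fun_scale \<phi> X) Y = fun_scale \<phi> (nabla X Y)"
    "nabla X (fun_scale \<phi> Y) = fun_scale (deriv_along X \<phi>) Y + fun_scale \<phi> (nabla X Y)"
  using lc assms unfolding levi_civita_def affine_connection_def by blast+

lemma torsion_free: "X \<in> vector_fields \<Longrightarrow> Y \<in> vector_fields \<Longrightarrow> nabla X Y - nabla Y X = lie_bracket X Y"
  using lc unfolding levi_civita_def by blast

lemma compatible:
  "X \<in> vector_fields \<Longrightarrow> Y \<in> vector_fields \<Longrightarrow> Z \<in> vector_fields \<Longrightarrow>
    X p (\<lambda>q. g q (Y q) (Z q)) = g p (nabla X Y p) (Z p) + g p (Y p) (nabla X Z p)"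
  using lc unfolding levi_civita_def deriv_along_def by blast

text \<open>Torsion freeness exhibits the bracket as a difference of two vector fields, so tangency
  requires no computation in coordinates.\<close>

lemma bracket_tangent: 
  assumes "X \<in> vector_fields" "Y \<in> vector_fields" shows "lie_bracket X Y p \<in> tangent_space p"
proof -
  have "lie_bracket X Y p = nabla X Y p - nabla Y X p"
    by (simp add: torsion_free[OF assms, symmetric])
  then show ?thesis using assms by (simp add: vector_fields_tangent)
qed

lemma f_fund_crd:
  assumes "x \<in> SU3" "B \<in> su3"
  shows "f (proj x) (fund B (proj x)) (crd j K) = Re (commutator (conjugate x K) (F (conjugate x B)) $ j $ j)"
  using assms by (simp add: f_fund fund_crd conjugate_commutator)

text \<open>Infinitesimal invariance of f, tested on coordinate functions. By
  \<open>fund_bilinear\<close> the derivative along \<open>fund A\<close> has two terms; the one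
  that differentiates the coordinate function cancels against the second half of the
  bracket.\<close>

lemma bracket_f:
  assumes "A \<in> su3" "B \<in> su3"
  shows "lie_bracket (fund A) (tensor_apply f (fund B)) = tensor_apply f (fund (commutator B A))"
proof
  fix p
  obtain x where x: "x \<in> SU3" "p = proj x" using proj_cases by blast
  show "lie_bracket (fund A) (tensor_apply f (fund B)) p = tensor_apply f (fund (commutator B A)) p"
  proof (rule tangent_eqI[of _ p])
    fix j K
    let ?R = "\<lambda>B K. Re (commutator K (F B) $ j $ j)"
    have R: "bounded_bilinear ?R"
      unfolding bilinear_conv_bounded_bilinear[symmetric] bilinear_def
      by (auto intro!: linearI simp: commutator_add_left commutator_add_right commutator_scaleR_left commutator_scaleR_right fmap_add fmap_scaleR)
    have "smooth_fun (\<lambda>p. f p (fund B p) (crd j K))"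
      using vector_fields_smooth[OF f_fields[OF fund_in_vector_fields[OF assms(2)]] smooth_crd[of j K]]
      by (simp add: tensor_apply_def)
    from fund_bilinear[OF this x(1) assms(1) R, where K = B and L = K]
    have "fund A p (\<lambda>p. f p (fund B p) (crd j K)) = ?R (conjugate x B) (conjugate x (commutator K A)) + ?R (conjugate x (commutator B A)) (conjugate x K)"
      using assms x by (simp add: f_fund_crd)
    moreover have "f p (fund B p) (\<lambda>p. fund A p (crd j K)) = ?R (conjugate x B) (conjugate x (commutator K A))"
      using assms x by (simp add: fund_crd f_fund_crd)
    ultimately show "lie_bracket (fund A) (tensor_apply f (fund B)) p (crd j K) = tensor_apply f (fund (commutator B A)) p (crd j K)"
      using assms x by (simp add: lie_bracket_def deriv_along_def tensor_apply_def f_fund_crd)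
  qed (use assms in \<open>simp_all add: bracket_tangent vector_fields_tangent\<close>)
qed

text \<open>On coordinate functions this is the Jacobi identity for commutators. The order is
  reversed because the group acts from the left.\<close>

lemma bracket_fund:
  assumes "A \<in> su3" "B \<in> su3"
  shows "lie_bracket (fund A) (fund B) = fund (commutator B A)"
proof
  fix p
  show "lie_bracket (fund A) (fund B) p = fund (commutator B A) p"
  proof (rule tangent_eqI[of _ p])
    fix j K
    obtain x where x: "x \<in> SU3" "p = proj x" using proj_cases by blast
    have "commutator (commutator K B) A - commutator (commutator K A) B = commutator K (commutator B A)"
      by (simp add: commutator_def matrix_mul_assoc bounded_bilinear.diff_left[OF bounded_bilinear_mat3]
          bounded_bilinear.diff_right[OF bounded_bilinear_mat3])
    then have "conjugate x (commutator K (commutator B A)) = conjugate x (commutator (commutator K B) A) - conjugate x (commutator (commutator K A) B)"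
      by (metis conjugate_diff)
    then have "crd j (commutator (commutator K B) A) p - crd j (commutator (commutator K A) B) p = crd j (commutator K (commutator B A)) p"
      using x by simp
    then show "lie_bracket (fund A) (fund B) p (crd j K) = fund (commutator B A) p (crd j K)"
      using assms by (simp add: lie_bracket_def deriv_along_def fund_crd)
  qed (use assms in \<open>simp_all add: bracket_tangent\<close>)
qed

lemma fund_g:
  assumes "A \<in> su3" "B \<in> su3" "C \<in> su3" "x \<in> SU3"
  shows "fund A (proj x) (\<lambda>p. g p (fund B p) (fund C p)) =
    q (conjugate x B) (conjugate x (commutator C A)) + q (conjugate x (commutator B A)) (conjugate x C)"
  using fund_bilinear[OF g_smooth[of "fund B" "fund C"] assms(4,1) bounded_bilinear_qform, where K = B and L = C] assms
  by (simp add: g_fund)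

text \<open>For fundamental fields the derivative of a scalar product is itself a sum of commutator
  terms. Three instances of compatibility and three of torsion freeness thus become linear equations
  that determine the connection.\<close>

lemma koszul_formula:
  assumes "A \<in> su3" "B \<in> su3" "C \<in> su3" and x: "x \<in> SU3"
  shows "2 * g (proj x) (nabla (fund B) (fund A) (proj x)) (fund C (proj x)) = koszul (l1, l2, l3) (conjugate x B) (conjugate x A) (conjugate x C)"
proof -
  let ?p = "proj x"
  define n where "n A B C = g ?p (nabla (fund A) (fund B) ?p) (fund C ?p)" for A B C
  have tan: "nabla (fund A) (fund B) ?p \<in> tangent_space ?p" if "A \<in> su3" "B \<in> su3" for A B
    using that by (simp add: vector_fields_tangent)
  have compat: "n A B C + n A C B = q (conjugate x B) (conjugate x (commutator C A)) + q (conjugate x (commutator B A)) (conjugate x C)"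
    if "A \<in> su3" "B \<in> su3" "C \<in> su3" for A B C
    using compatible[of "fund A" "fund B" "fund C" ?p] that x tan[of A C] 
    by (simp add: n_def fund_g g_sym[of "fund B ?p"])
  have tors: "n A B C - n B A C = q (conjugate x (commutator B A)) (conjugate x C)" if s: "A \<in> su3" "B \<in> su3" "C \<in> su3" for A B C
  proof -
    have "nabla (fund A) (fund B) ?p - nabla (fund B) (fund A) ?p = fund (commutator B A) ?p"
      using fun_cong[OF torsion_free[of "fund A" "fund B"], of ?p] s by (simp add: bracket_fund)
    then show ?thesis
      using s x tan[of A B] tan[of B A] by (simp add: n_def g_fund flip: g_diff)
  qed
  let ?T = "\<lambda>A B C. q (conjugate x (commutator A B)) (conjugate x C)"
  have anti: "?T A B C = - ?T B A C" for A B C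
    unfolding commutator_minus_swap[of A B, symmetric] conjugate_minus qform_minus_left by simp
  have "2 * n B A C = ?T A B C + ?T C B A + ?T C A B"
    using compat[of B A C] compat[of A C B] compat[of C B A] tors[of A B C] tors[of B C A] tors[of A C B] assms
      anti[of A B C] anti[of B C A] anti[of A C B]
      qform_sym[of _ "conjugate x A"] qform_sym[of _ "conjugate x B"] qform_sym[of _ "conjugate x C"]
    by (smt (verit))
  then show ?thesis using x by (simp add: n_def koszul_def conjugate_commutator)
qed

lemma nabla_f_fund:
  assumes "A \<in> su3" "B \<in> su3" "C \<in> su3" and x: "x \<in> SU3"
  shows "2 * g (proj x) (nabla_f nabla f (fund A) (fund B) (proj x)) (fund C (proj x)) =
    koszul (l1, l2, l3) (F (conjugate x B)) (conjugate x A) (conjugate x C) + koszul (l1, l2, l3) (conjugate x B) (conjugate x A) (F (conjugate x C))"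
proof -
  let ?p = "proj x"
  have tan: "nabla (fund A) (fund B) ?p \<in> tangent_space ?p" if "A \<in> su3" "B \<in> su3" for A B
    using that by (simp add: vector_fields_tangent)
  define B' C' where "B' = conjugate (adj x) (F (conjugate x B))" and "C' = conjugate (adj x) (F (conjugate x C))"
  have s: "B' \<in> su3" "C' \<in> su3" using x by (simp_all add: B'_def C'_def)
  have 1: "nabla (fund A) (tensor_apply f (fund B)) ?p = nabla (tensor_apply f (fund B)) (fund A) ?p + f ?p (fund (commutator B A) ?p)"
    using fun_cong[OF torsion_free[of "fund A" "tensor_apply f (fund B)"], of ?p] assms
    by (simp add: bracket_f tensor_apply_def[of f "fund (commutator B A)"] algebra_simps)
  have "nabla (fund A) (fund B) ?p = nabla (fund B) (fund A) ?p + fund (commutator B A) ?p"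
    using fun_cong[OF torsion_free[of "fund A" "fund B"], of ?p] assms
    by (simp add: bracket_fund algebra_simps)
  then have 2: "f ?p (nabla (fund A) (fund B) ?p) = f ?p (nabla (fund B) (fund A) ?p) + f ?p (fund (commutator B A) ?p)"
    using assms tan by (simp add: f_add)
  have "tensor_apply f (fund B) ?p = fund B' ?p"
    using assms by (simp add: tensor_apply_def f_fund B'_def)
  \<comment> \<open>The image of a fundamental field under f is not fundamental, but it agrees at
    this point with \<open>fund B'\<close>. It stands in the direction slot of the connection, which
    is tensorial.\<close>
  then have 3: "nabla (tensor_apply f (fund B)) (fund A) ?p = nabla (fund B') (fund A) ?p"
    by (rule tensorial[where T = "\<lambda>X. nabla X (fund A)", rotated 4])
      (use assms s in \<open>simp_all add: nabla_add nabla_scale\<close>)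
  have "nabla_f nabla f (fund A) (fund B) ?p = nabla (fund B') (fund A) ?p - f ?p (nabla (fund B) (fund A) ?p)"
    using 1 2 3 by (simp add: nabla_f_def tensor_apply_def)
  \<comment> \<open>Skewness moves f onto the third argument, and the sign turns the difference into
    the sum treated by \<open>koszul_fmap\<close>.\<close>
  moreover have "g ?p (f ?p (nabla (fund B) (fund A) ?p)) (fund C ?p) = - g ?p (nabla (fund B) (fund A) ?p) (fund C' ?p)"
  proof -
    have "g ?p (f ?p (nabla (fund B) (fund A) ?p)) (fund C ?p) + g ?p (nabla (fund B) (fund A) ?p) (f ?p (fund C ?p)) = 0"
      using metric_f tan assms unfolding metric_f_structure_def by simp
    then show ?thesis using assms by (simp add: f_fund C'_def)
  qed
  ultimately have "g ?p (nabla_f nabla f (fund A) (fund B) ?p) (fund C ?p)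
    = g ?p (nabla (fund B') (fund A) ?p) (fund C ?p) + g ?p (nabla (fund B) (fund A) ?p) (fund C' ?p)"
    using assms s tan by (simp add: g_diff)
  then show ?thesis
    using koszul_formula[of A B' C x] koszul_formula[of A B C' x] assms s
    by (simp add: B'_def C'_def)
qed

lemma nabla_f_fields_tangent:
  "X \<in> vector_fields \<Longrightarrow> Y \<in> vector_fields \<Longrightarrow> nabla_f nabla f X Y p \<in> tangent_space p"
  by (simp add: nabla_f_def vector_fields_tangent)

text \<open>In the second argument the Leibniz rule produces the derivative of the factor times f Y
  twice, once from each half of \<open>nabla_f\<close>; the two terms cancel because f is linear
  over functions.\<close>

lemma nabla_f_tensorial:
  assumes "X \<in> vector_fields" "Y \<in> vector_fields" "A \<in> su3" "B \<in> su3" "X p = fund A p" "Y p = fund B p"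
  shows "nabla_f nabla f X Y p = nabla_f nabla f (fund A) (fund B) p"
proof -
  have f_scale': "tensor_apply f (fun_scale \<phi> X) = fun_scale \<phi> (tensor_apply f X)" if "X \<in> vector_fields" for \<phi> X
    using that by (simp add: tensor_apply_def fun_scale_def f_scale vector_fields_tangent)
  have f_add': "tensor_apply f (X + Y) = tensor_apply f X + tensor_apply f Y"
    if "X \<in> vector_fields" "Y \<in> vector_fields" for X Y
    using that by (simp add: tensor_apply_def fun_eq_iff f_add vector_fields_tangent)
  have scale_diff: "fun_scale \<phi> (X - Y) = fun_scale \<phi> X - fun_scale \<phi> Y" for \<phi> X Y
    by (simp add: fun_scale_def fun_eq_iff scaleR_diff_right)
  have "nabla_f nabla f X Y p = nabla_f nabla f (fund A) Y p"
    by (rule tensorial[where T = "\<lambda>X. nabla_f nabla f X Y"])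
      (use assms in \<open>simp_all add: nabla_f_def nabla_add nabla_scale f_add' f_scale' scale_diff\<close>)
  also have "\<dots> = nabla_f nabla f (fund A) (fund B) p"
  proof (rule tensorial[where T = "\<lambda>Y. nabla_f nabla f (fund A) Y"])
    fix Y \<phi> assume Y: "Y \<in> vector_fields" and \<phi>: "smooth_fun \<phi>"
    have "smooth_fun (deriv_along (fund A) \<phi>)"
      using vector_fields_smooth[of "fund A" \<phi>] assms \<phi> by (simp add: deriv_along_def)
    then show "nabla_f nabla f (fund A) (fun_scale \<phi> Y) = fun_scale \<phi> (nabla_f nabla f (fund A) Y)"
      using Y \<phi> assms
      by (simp add: nabla_f_def nabla_scale f_scale' f_add' scale_diff)
  qed (use assms in \<open>simp_all add: nabla_f_def nabla_add f_add'\<close>)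
  finally show ?thesis .
qed

lemma tangent_zeroI:
  assumes "v \<in> tangent_space p" "\<And>C. C \<in> su3 \<Longrightarrow> g p v (fund C p) = 0" shows "v = 0"
  using assms g_pos by (metis less_irrefl tangent_spaceE)

abbreviation "u1 \<equiv> (l2 + l3 - l1) * (z2 + z3)"
abbreviation "u2 \<equiv> (l1 + l3 - l2) * (z1 + z3)"
abbreviation "u3 \<equiv> (l1 + l2 - l3) * (z1 + z2)"

lemma g_zero: "C \<in> su3 \<Longrightarrow> g p 0 (fund C p) = 0"
  using g_scale[of 0 p "fund C p" 0] by simp

lemma nabla_f_zero_iff:
  assumes "A \<in> su3" "B \<in> su3" and x: "x \<in> SU3"
  shows "nabla_f nabla f (fund A) (fund B) (proj x) = 0 \<longleftrightarrow>
    (\<forall>C\<in>su3. koszul (l1, l2, l3) (F (conjugate x B)) (conjugate x A) (conjugate x C) + koszul (l1, l2, l3) (conjugate x B) (conjugate x A) (F (conjugate x C)) = 0)"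
  using nabla_f_fund[OF assms(1,2) _ x] nabla_f_fields_tangent[of "fund A" "fund B" "proj x"] assms
    tangent_zeroI[of "nabla_f nabla f (fund A) (fund B) (proj x)" "proj x"] g_zero[of _ "proj x"]
  by (metis fund_in_vector_fields mult_eq_0_iff mult_zero_right zero_neq_numeral)

lemma kaehler_iff: "kaehler_f_structure g nabla f \<longleftrightarrow> u1 = 0 \<and> u2 = 0 \<and> u3 = 0"
proof
  assume "kaehler_f_structure g nabla f"
  then have "nabla_f nabla f (fund A) (fund B) (proj (mat 1)) = 0" if "A \<in> su3" "B \<in> su3" for A B
    using that by (simp add: kaehler_f_structure_def)
  then have *: "koszul (l1, l2, l3) (F B) A C + koszul (l1, l2, l3) B A (F C) = 0"
    if "A \<in> su3" "B \<in> su3" "C \<in> su3" for A B C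
    using that nabla_f_zero_iff[of A B "mat 1"] by simp
  \<comment> \<open>Each triple takes one matrix from each root space, which isolates one
    coefficient; the entry \<open>\<i>\<close> in A makes the real part nonzero.\<close>
  show "u1 = 0 \<and> u2 = 0 \<and> u3 = 0"
    using *[of "D \<i> 0 0" "D 0 0 1" "D 0 1 0"] *[of "D 0 \<i> 0" "D 1 0 0" "D 0 0 1"] *[of "D 0 0 \<i>" "D 0 1 0" "D 1 0 0"]
    by (simp add: koszul_fmap)
next
  assume u: "u1 = 0 \<and> u2 = 0 \<and> u3 = 0"
  have "nabla_f nabla f X Y = 0" if XY: "X \<in> vector_fields" "Y \<in> vector_fields" for X Y
  proof
    fix p
    obtain x where x: "x \<in> SU3" "p = proj x" using proj_cases by blast
    obtain A B where AB: "A \<in> su3" "B \<in> su3" "X p = fund A p" "Y p = fund B p"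
      using XY vector_fields_tangent tangent_spaceE by metis
    have "nabla_f nabla f (fund A) (fund B) (proj x) = 0"
      using nabla_f_zero_iff[OF AB(1,2) x(1)] u AB x by (simp add: koszul_fmap del: mult_eq_0_iff)
    then show "nabla_f nabla f X Y p = 0 p"
      using nabla_f_tensorial[OF XY AB] x by simp
  qed
  then show "kaehler_f_structure g nabla f"
    using metric_f by (simp add: kaehler_f_structure_def)
qed

text \<open>If \<open>B = A\<close>, the three real parts in \<open>koszul_fmap\<close> sum to zero
  identically. A common value of the coefficients therefore factors out, and conversely only their
  differences can be detected.\<close>

lemma killing_iff: "killing_f_structure g nabla f \<longleftrightarrow> u1 = u2 \<and> u2 = u3"
proof
  assume "killing_f_structure g nabla f"
  then have "nabla_f nabla f (fund A) (fund A) (proj (mat 1)) = 0" if "A \<in> su3" for A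
    using that by (simp add: killing_f_structure_def)
  then have *: "koszul (l1, l2, l3) (F A) A C + koszul (l1, l2, l3) A A (F C) = 0"
    if "A \<in> su3" "C \<in> su3" for A C
    using that nabla_f_zero_iff[of A A "mat 1"] by simp
  \<comment> \<open>With A in two root spaces and C in the third, exactly two of the three terms
    survive, with opposite signs.\<close>
  show "u1 = u2 \<and> u2 = u3"
    using *[of "D \<i> 1 0" "D 0 0 1"] *[of "D 0 \<i> 1" "D 1 0 0"]
    by (simp add: koszul_fmap)
next
  assume u: "u1 = u2 \<and> u2 = u3"
  have "nabla_f nabla f X X = 0" if X: "X \<in> vector_fields" for X
  proof
    fix p
    obtain x where x: "x \<in> SU3" "p = proj x" using proj_cases by blast
    obtain A where A: "A \<in> su3" "X p = fund A p"
      using X vector_fields_tangent tangent_spaceE by metis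
    have "koszul (l1, l2, l3) (F A) A C + koszul (l1, l2, l3) A A (F C) = 0" if "A \<in> su3" "C \<in> su3" for A C
    proof -
      have u': "u1 = u3" "u2 = u3" using u by simp_all
      show ?thesis
        unfolding koszul_fmap[OF that(1) that(1) that(2)] u' by (simp add: algebra_simps)
    qed
    then have "nabla_f nabla f (fund A) (fund A) (proj x) = 0"
      using nabla_f_zero_iff[OF A(1) A(1) x(1)] A x by simp
    then show "nabla_f nabla f X X p = 0 p"
      using nabla_f_tensorial[OF X X A(1) A(1) A(2) A(2)] x by simp
  qed
  then show "killing_f_structure g nabla f"
    using metric_f by (simp add: killing_f_structure_def)
qed

end

section \<open>Solving the Killing equations for the parameters\<close>

lemma killing_nonkaehler_cases:
  fixes l1 l2 l3 z1 z2 z3 :: real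
  assumes l: "l1 > 0" "l2 > 0" "l3 > 0"
    and z: "z1 \<in> {-1, 0, 1}" "z2 \<in> {-1, 0, 1}" "z3 \<in> {-1, 0, 1}"
  defines "u1 \<equiv> (l2 + l3 - l1) * (z2 + z3)" and "u2 \<equiv> (l1 + l3 - l2) * (z1 + z3)"
    and "u3 \<equiv> (l1 + l2 - l3) * (z1 + z2)"
  shows "(u1 = u2 \<and> u2 = u3) \<and> \<not> (u1 = 0 \<and> u2 = 0 \<and> u3 = 0) \<longleftrightarrow>
    (\<exists>((w1, w2, w3), (m1, m2, m3)) \<in>
         {((1, 1, 1), (1, 1, 1)), ((1, 1, 0), (3, 3, 4)), ((1, 0, 1), (3, 4, 3)), ((0, 1, 1), (4, 3, 3))}.
       \<exists>s\<in>{1, -1}. \<exists>c>0. (z1 = s * w1 \<and> z2 = s * w2 \<and> z3 = s * w3) \<and> (l1 = c * m1 \<and> l2 = c * m2 \<and> l3 = c * m3))"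
    (is "?L \<longleftrightarrow> ?R")
proof
  assume ?L
  then have e: "u1 = u2" "u2 = u3" and "u1 \<noteq> 0" "u2 \<noteq> 0" "u3 \<noteq> 0" by auto
  \<comment> \<open>Nonzero pairwise sums exclude opposite signs and a second zero, so at most one
    parameter vanishes and the others share a sign.\<close>
  then have "z2 + z3 \<noteq> 0" "z1 + z3 \<noteq> 0" "z1 + z2 \<noteq> 0" by (auto simp: u1_def u2_def u3_def)
  with z consider "z1 = z2" "z2 = z3" "z1 \<in> {1, -1}" | "z1 = z2" "z3 = 0" "z1 \<in> {1, -1}"
    | "z1 = z3" "z2 = 0" "z1 \<in> {1, -1}" | "z2 = z3" "z1 = 0" "z2 \<in> {1, -1}"
    by (elim insertE emptyE) simp_all
  \<comment> \<open>If all parameters agree, so do the metric coefficients. If \<open>z3\<close> is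
    the zero one, then \<open>u1 = u2\<close> gives \<open>l1 = l2\<close>, and the doubled factor
    in \<open>u3\<close> gives \<open>l3 = 2 * (2 * l1 - l3)\<close>; this is the ratio 3 : 4. The
    other cases are permutations of it.\<close>
  then consider
    "z1 = z2" "z2 = z3" "z1 \<in> {1, -1}" "l1 = l2" "l2 = l3"
    | "z1 = z2" "z3 = 0" "z1 \<in> {1, -1}" "l1 = l2" "3 * l3 = 4 * l1"
    | "z1 = z3" "z2 = 0" "z1 \<in> {1, -1}" "l1 = l3" "3 * l2 = 4 * l1"
    | "z2 = z3" "z1 = 0" "z2 \<in> {1, -1}" "l2 = l3" "3 * l1 = 4 * l2"
  proof cases
    case 1
    with e show ?thesis by (intro that(1)) (auto simp: u1_def u2_def u3_def)
  next
    case 2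
    with e show ?thesis by (intro that(2)) (auto simp: u1_def u2_def u3_def)
  next
    case 3
    with e show ?thesis by (intro that(3)) (auto simp: u1_def u2_def u3_def)
  next
    case 4
    with e show ?thesis by (intro that(4)) (auto simp: u1_def u2_def u3_def)
  qed
  then show ?R
  proof cases
    case 1
    then show ?thesis using l by simp
  next
    case 2
    then have "\<exists>c>0. l1 = c * 3 \<and> l2 = c * 3 \<and> l3 = c * 4"
      using l by (intro exI[of _ "l1 / 3"]) simp
    with 2 show ?thesis by auto
  next
    case 3
    then have "\<exists>c>0. l1 = c * 3 \<and> l2 = c * 4 \<and> l3 = c * 3"
      using l by (intro exI[of _ "l1 / 3"]) simp
    with 3 show ?thesis by auto
  next
    case 4
    then have "\<exists>c>0. l1 = c * 4 \<and> l2 = c * 3 \<and> l3 = c * 3"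
      using l by (intro exI[of _ "l2 / 3"]) simp
    with 4 show ?thesis by auto
  qed
next
  assume ?R
  then show ?L by (auto simp: u1_def u2_def u3_def)
qed

text \<open>If only \<open>z3\<close> were nonzero, the third expression would vanish and hence the
  other two as well, although their sum is \<open>2 * l3 * z3\<close>. The other indices are
  symmetric.\<close>

lemma killing_support:
  fixes l1 l2 l3 z1 z2 z3 :: real
  assumes "l1 > 0" "l2 > 0" "l3 > 0"
    and "(l2 + l3 - l1) * (z2 + z3) = (l1 + l3 - l2) * (z1 + z3)"
    and "(l1 + l3 - l2) * (z1 + z3) = (l1 + l2 - l3) * (z1 + z2)"
  shows "z1 = 0 \<and> z2 = 0 \<and> z3 = 0 \<or> z1 \<noteq> 0 \<and> z2 \<noteq> 0 \<or> z1 \<noteq> 0 \<and> z3 \<noteq> 0 \<or> z2 \<noteq> 0 \<and> z3 \<noteq> 0"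
proof (rule ccontr)
  assume "\<not> ?thesis"
  then consider "z1 = 0" "z2 = 0" "z3 \<noteq> 0" | "z1 = 0" "z3 = 0" "z2 \<noteq> 0" | "z2 = 0" "z3 = 0" "z1 \<noteq> 0" by auto
  then show False using assms by cases auto
qed

text \<open>Each nonzero parameter contributes a complex line, that is two real dimensions, so rank
  2 would mean exactly one nonzero parameter. It suffices to exhibit three independent vectors in
  the image, or to see that it is zero.\<close>

lemma dim_image_f_structure:
  assumes f: "f_structure_is f (z1, z2, z3)"
    and z: "z1 = 0 \<and> z2 = 0 \<and> z3 = 0 \<or> z1 \<noteq> 0 \<and> z2 \<noteq> 0 \<or> z1 \<noteq> 0 \<and> z3 \<noteq> 0 \<or> z2 \<noteq> 0 \<and> z3 \<noteq> 0"
  shows "dim (f base_point ` tangent_space base_point) \<noteq> 2"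
proof
  define h where "h = (\<lambda>(a, b, c). dproj (D a b c))"
  let ?V = "f base_point ` tangent_space base_point"
  assume dim: "dim ?V = 2"
  have f': "f base_point (h (a, b, c)) = h (of_real z1 * \<i> * a, of_real z2 * \<i> * b, of_real z3 * \<i> * c)" for a b c
    using f by (simp add: f_structure_is_def h_def)
  have T: "h x \<in> tangent_space base_point" for x
    by (simp add: h_def case_prod_beta)
  have h_lin: "linear h"
    by (intro linearI) (auto simp: h_def D_add D_scaleR simp flip: dproj_add dproj_scaleR)
  have h_inj: "inj h"
    by (auto simp: inj_def h_def dproj_D_inject)
  have V: "h (a, b, c) \<in> ?V" if "z1 = 0 \<longrightarrow> a = 0" "z2 = 0 \<longrightarrow> b = 0" "z3 = 0 \<longrightarrow> c = 0" for a b c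
  proof -
    \<comment> \<open>For a vanishing parameter the quotient is 0 by convention, consistent with the
      component being 0.\<close>
    have "h (a, b, c) = f base_point (h (a / (of_real z1 * \<i>), b / (of_real z2 * \<i>), c / (of_real z3 * \<i>)))"
      using that unfolding f' by (auto simp: field_simps)
    then show ?thesis using T by blast
  qed
  obtain B where B: "B \<subseteq> ?V" "?V \<subseteq> span B" "independent B" "card B = 2"
    using basis_exists[of ?V] dim by metis
  have "finite B" using B(4) card_ge_0_finite[of B] by simp
  \<comment> \<open>Three independent vectors cannot lie in the span of two. The parameter space of
    triples supplies them, since \<open>h\<close> is linear and injective.\<close>
  have no: False if C: "C \<subseteq> Basis" "card C = 3" "h ` C \<subseteq> ?V" for C
  proof -
    have "independent C" using C(1) independent_Basis independent_mono by blast
    then have "independent (h ` C)"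
      using h_lin h_inj by (intro linear_independent_injective_image) (auto intro: inj_on_subset)
    moreover have "card (h ` C) = 3"
      using C(2) h_inj by (simp add: card_image inj_on_subset)
    ultimately show False
      using independent_span_bound[OF \<open>finite B\<close> _ order_trans[OF C(3) B(2)]] B(4) by simp
  qed
  from z show False
  proof (elim disjE conjE)
    assume 0: "z1 = 0" "z2 = 0" "z3 = 0"
    have "?V \<subseteq> {0}"
    proof
      fix v assume "v \<in> ?V"
      then obtain a b c where "v = f base_point (h (a, b, c))"
        unfolding tangent_space_base h_def by auto
      then show "v \<in> {0}" using 0 by (simp add: f') (simp add: h_def D_0)
    qed
    with B(1) have "B \<subseteq> {0}" by (rule order_trans)
    moreover have "0 \<notin> B" using B(3) dependent_zero by metis
    ultimately have "B = {}" by auto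
    then show False using B(4) by simp
  next
    assume "z1 \<noteq> 0" "z2 \<noteq> 0"
    then show False
      by (intro no[of "{(1, 0, 0), (\<i>, 0, 0), (0, 1, 0)}"])
        (auto simp: Basis_prod_def Basis_complex_def zero_prod_def V)
  next
    assume "z1 \<noteq> 0" "z3 \<noteq> 0"
    then show False
      by (intro no[of "{(1, 0, 0), (\<i>, 0, 0), (0, 0, 1)}"])
        (auto simp: Basis_prod_def Basis_complex_def zero_prod_def V)
  next
    assume "z2 \<noteq> 0" "z3 \<noteq> 0"
    then show False
      by (intro no[of "{(0, 1, 0), (0, \<i>, 0), (0, 0, 1)}"])
        (auto simp: Basis_prod_def Basis_complex_def zero_prod_def V)
  qed
qed

theorem proposition2:
  fixes g :: metric and nabla :: connection
  assumes "invariant_metric g" and "levi_civita g nabla"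
  shows "(\<forall>f. invariant_f_structure f \<longrightarrow>
            (strictly_killing_f_structure g nabla f \<longleftrightarrow>
              (\<exists>((z1, z2, z3), (l1, l2, l3)) \<in>
                   {((1, 1, 1), (1, 1, 1)),
                    ((1, 1, 0), (3, 3, 4)),
                    ((1, 0, 1), (3, 4, 3)),
                    ((0, 1, 1), (4, 3, 3))}.
                 \<exists>s\<in>{1, -1}. \<exists>c>0.
                   f_structure_is f (s * z1, s * z2, s * z3) \<and>
                   metric_is g (c * l1, c * l2, c * l3)))) \<and>
         \<not> (\<exists>f. invariant_f_structure f \<and> killing_f_structure g nabla f \<and> has_rank f 2)"
proof -
  obtain l1 l2 l3 where l: "l1 > 0" "l2 > 0" "l3 > 0" and g: "metric_is g (l1, l2, l3)"
    using invariant_metric_ex[OF assms(1)] by blast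
  \<comment> \<open>Uniqueness of the coefficients turns the existential description in the theorem
    into equations between real numbers.\<close>
  have metric: "metric_is g (m1, m2, m3) \<longleftrightarrow> l1 = m1 \<and> l2 = m2 \<and> l3 = m3" for m1 m2 m3
    using g metric_is_unique[OF g] by blast
  show ?thesis
  proof (intro conjI allI impI notI)
    fix f assume inv: "invariant_f_structure f"
    obtain z1 z2 z3 where z: "z1 \<in> {-1, 0, 1}" "z2 \<in> {-1, 0, 1}" "z3 \<in> {-1, 0, 1}"
      and f: "f_structure_is f (z1, z2, z3)"
      using invariant_f_structure_ex[OF inv] by blast
    have struct: "f_structure_is f (w1, w2, w3) \<longleftrightarrow> z1 = w1 \<and> z2 = w2 \<and> z3 = w3" for w1 w2 w3
      using f f_structure_is_unique[OF f] by blast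
    interpret flag_structures g nabla f l1 l2 l3 z1 z2 z3
      using assms inv f g by unfold_locales
    show "strictly_killing_f_structure g nabla f \<longleftrightarrow>
              (\<exists>((z1, z2, z3), (l1, l2, l3)) \<in>
                   {((1, 1, 1), (1, 1, 1)),
                    ((1, 1, 0), (3, 3, 4)),
                    ((1, 0, 1), (3, 4, 3)),
                    ((0, 1, 1), (4, 3, 3))}.
                 \<exists>s\<in>{1, -1}. \<exists>c>0.
                   f_structure_is f (s * z1, s * z2, s * z3) \<and>
                   metric_is g (c * l1, c * l2, c * l3))"
      unfolding strictly_killing_f_structure_def killing_iff kaehler_iff metric struct
      by (rule killing_nonkaehler_cases[OF l z])
  next
    assume "\<exists>f. invariant_f_structure f \<and> killing_f_structure g nabla f \<and> has_rank f 2"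
    then obtain f where inv: "invariant_f_structure f" and k: "killing_f_structure g nabla f" and r: "has_rank f 2"
      by blast
    obtain z1 z2 z3 where f: "f_structure_is f (z1, z2, z3)"
      using invariant_f_structure_ex[OF inv] by blast
    interpret flag_structures g nabla f l1 l2 l3 z1 z2 z3
      using assms inv f g by unfold_locales
    have "dim (f base_point ` tangent_space base_point) \<noteq> 2"
      using killing_support[OF l] k killing_iff by (intro dim_image_f_structure[OF f]) blast
    with r show False by (simp add: has_rank_def)
  qed
qed

end
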